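(* Assume that for every $\gamma>1$ there exists a rate-1 efficient $\mu$-conditionally secure entropy-preserving pseudorandom generator $G:\{0,1\}^n\to\{0,1\}^{n+\gamma\log n}$ with $\mu(n)=1/n^2$. Then for every constant $d>0$, every constant $\varepsilon>0$, and every polynomial $t(n)\geq(1+\varepsilon)n$, $K^t$ is mildly hard-on-average to $(d\log n)$-approximate.
   Context: Fix a universal Turing machine $U$ that emulates any Turing machine with polynomial overhead. A description $\Pi\in\{0,1\}^*$ encodes a pair $(M,w)$ of a single-tape Turing machine $M$ and an input $w$; $U(\Pi,1^t)$ denotes the output of $M(w)$ emulated on $U$ for $t$ steps. $K^t(x)=\min\{|\Pi| : U(\Pi,1^{t(|x|)})=x\}$. A function $f$ is mildly hard-on-average to $\beta$-approximate if there is a polynomial $p>0$ such that for every probabilistic polynomial-time (PPT) heuristic $H$ and all sufficiently large $n$, $\Pr[x\leftarrow\{0,1\}^n: |H(x)-f(x)|\leq\beta(|x|)]<1-\frac{1}{p(n)}$. Ensembles $\{A_n\}$, $\{B_n\}$ are $\mu(\cdot)$-indistinguishable if for every probabilistic distinguisher $D$ running in time polynomial in its first input there is $n_0$ with $|\Pr[D(1^n,A_n)=1]-\Pr[D(1^n,B_n)=1]|<\mu(n)$ for all $n\geq n_0$. $\mathcal{U}_n$ is uniform on $\{0,1\}^n$; $H$ denotes Shannon entropy. An efficiently computable $G:\{0,1\}^n\to\{0,1\}^{n+\gamma\log n}$ is a $\mu$-conditionally secure entropy-preserving pseudorandom generator if there exist events $E_n\subseteq\{0,1\}^n$ and a constant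 $\alpha$ such that (i) $\{G(\mathcal{U}_n\mid E_n)\}_n$ and $\{\mathcal{U}_{n+\gamma\log n}\}_n$ are $\mu(n)$-indistinguishable, and (ii) for all sufficiently large $n$, $H(G(\mathcal{U}_n\mid E_n))\geq n-\alpha\log n$. $G$ is rate-1 efficient if its running time on inputs of length $n$ is at most $n+O(n^{\varepsilon'})$ for some constant $\varepsilon'<1$. *)

theory Defs
  imports
    "HOL-Probability.Probability"
    "HOL-Computational_Algebra.Polynomial"
    "HOL-Library.Landau_Symbols"
begin

section \<open>Turing machines\<close>

text \<open>
  A machine is a finite table, so every machine has finitely many states and symbols. The start
  state is 0, and a machine halts when its table has no entry for the current state and the
  symbols under its heads. Tapes are infinite in both directions. The first tape is the
  input/output tape: the input starts in cell 0, where all heads start, and the output is the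
  longest block of bits that starts in cell 0, wherever the head is.
\<close>

datatype symbol = Blank | is_Bit: Bit (the_bit: bool) | Work nat

datatype move = Left | Stay | Right

type_synonym tape = "int \<times> (int \<Rightarrow> symbol)"
type_synonym config = "nat \<times> tape list"
type_synonym action = "nat \<times> (symbol \<times> move) list"
type_synonym 'a table = "((nat \<times> symbol list) \<times> 'a) list"

type_synonym tm = "action table"

text \<open>A probabilistic machine tosses a fair coin in every step to choose between two actions.\<close>

type_synonym ptm = "(action \<times> action) table"

definition tm_tapes :: "nat \<Rightarrow> tm \<Rightarrow> bool" where
  "tm_tapes k M \<longleftrightarrow> k \<ge> 1 \<and>
     (\<forall>((q, ss), (q', as)) \<in> set M. length ss = k \<and> length as = k)"

definition ptm_tapes :: "nat \<Rightarrow> ptm \<Rightarrow> bool" where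
  "ptm_tapes k M \<longleftrightarrow> k \<ge> 1 \<and>
     (\<forall>((q, ss), ((q0, as0), (q1, as1))) \<in> set M.
        length ss = k \<and> length as0 = k \<and> length as1 = k)"

fun move_head :: "move \<Rightarrow> int \<Rightarrow> int" where
  "move_head Left h = h - 1"
| "move_head Stay h = h"
| "move_head Right h = h + 1"

fun tape_read :: "tape \<Rightarrow> symbol" where
  "tape_read (h, c) = c h"

fun tape_act :: "symbol \<times> move \<Rightarrow> tape \<Rightarrow> tape" where
  "tape_act (s, m) (h, c) = (move_head m h, c(h := s))"

fun perform :: "action \<Rightarrow> config \<Rightarrow> config" where
  "perform (q', as) (q, ts) = (q', map2 tape_act as ts)"

fun entry :: "'a table \<Rightarrow> config \<Rightarrow> 'a option" where
  "entry M (q, ts) = map_of M (q, map tape_read ts)"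

definition init :: "nat \<Rightarrow> bool list \<Rightarrow> config" where
  "init k x =
     (0, (0, \<lambda>i. if 0 \<le> i \<and> nat i < length x then Bit (x ! nat i) else Blank) #
         replicate (k - 1) (0, \<lambda>_. Blank))"

definition tape_bits :: "tape \<Rightarrow> bool list" where
  "tape_bits t =
     map (\<lambda>j. the_bit (snd t (int j))) [0..<(LEAST j. \<not> is_Bit (snd t (int j)))]"

definition tm_output :: "config \<Rightarrow> bool list" where
  "tm_output c = tape_bits (hd (snd c))"

definition tm_step :: "tm \<Rightarrow> config \<Rightarrow> config" where
  "tm_step M c = (case entry M c of None \<Rightarrow> c | Some a \<Rightarrow> perform a c)"

definition tm_result :: "nat \<Rightarrow> tm \<Rightarrow> bool list \<Rightarrow> nat \<Rightarrow> bool list option" where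
  "tm_result k M x t =
     (let c = (tm_step M ^^ t) (init k x)
      in if entry M c = None then Some (tm_output c) else None)"

definition ptm_step :: "ptm \<Rightarrow> config \<Rightarrow> config pmf" where
  "ptm_step M c =
     (case entry M c of
        None \<Rightarrow> return_pmf c
      | Some (a, b) \<Rightarrow>
          map_pmf (\<lambda>coin. perform (if coin then a else b) c) (bernoulli_pmf (1 / 2)))"

primrec ptm_run :: "ptm \<Rightarrow> nat \<Rightarrow> config \<Rightarrow> config pmf" where
  "ptm_run M 0 c = return_pmf c"
| "ptm_run M (Suc t) c = bind_pmf (ptm_step M c) (ptm_run M t)"

definition ptm_result_within ::
    "nat \<Rightarrow> ptm \<Rightarrow> bool list \<Rightarrow> nat \<Rightarrow> bool list pmf \<Rightarrow> bool" where
  "ptm_result_within k M x t P \<longleftrightarrow>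
     (\<forall>c \<in> set_pmf (ptm_run M t (init k x)). entry M c = None) \<and>
     P = map_pmf tm_output (ptm_run M t (init k x))"


section \<open>Efficient computation\<close>

text \<open>The pair \<open>(1\<^sup>n, y)\<close> as one input string.\<close>

definition unary_pair :: "nat \<Rightarrow> bool list \<Rightarrow> bool list" where
  "unary_pair n y = replicate n True @ False # y"

definition poly_time :: "(bool list \<Rightarrow> bool list) \<Rightarrow> bool" where
  "poly_time f \<longleftrightarrow>
     (\<exists>k M (p :: nat poly). tm_tapes k M \<and>
        (\<forall>x. tm_result k M x (poly p (length x)) = Some (f x)))"

definition ppt :: "(bool list \<Rightarrow> bool list pmf) \<Rightarrow> bool" where
  "ppt A \<longleftrightarrow>
     (\<exists>k M (p :: nat poly). ptm_tapes k M \<and>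
        (\<forall>x. ptm_result_within k M x (poly p (length x)) (A x)))"

definition ppt_distinguisher :: "(nat \<Rightarrow> bool list \<Rightarrow> bool list pmf) \<Rightarrow> bool" where
  "ppt_distinguisher D \<longleftrightarrow>
     (\<exists>k M (p :: nat poly). ptm_tapes k M \<and>
        (\<forall>n y. ptm_result_within k M (unary_pair n y) (poly p n) (D n y)))"

text \<open>
  Exact running times depend on the number \<open>k\<close> of tapes, so it is a parameter here and in the
  definition of universal machines below; \<open>k = 1\<close> gives single-tape machines.
\<close>

definition rate1_efficient :: "nat \<Rightarrow> (bool list \<Rightarrow> bool list) \<Rightarrow> bool" where
  "rate1_efficient k f \<longleftrightarrow>
     (\<exists>M (T :: nat \<Rightarrow> nat) (\<epsilon>' :: real). tm_tapes k M \<and>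
        (\<forall>x. tm_result k M x (T (length x)) = Some (f x)) \<and>
        \<epsilon>' < 1 \<and> (\<lambda>n. real (T n) - real n) \<in> O(\<lambda>n. real n powr \<epsilon>'))"


section \<open>Universal machines and time-bounded Kolmogorov complexity\<close>

text \<open>
  A universal machine emulates, on input \<open>(1\<^sup>t, \<pi>)\<close>, the first \<open>t\<close> steps of \<open>M(w)\<close>, where
  \<open>\<pi>\<close> describes the \<open>k\<close>-tape machine \<open>M\<close> and the input \<open>w\<close>; \<open>t\<close> counts the steps of \<open>M\<close>, and
  the emulation itself takes time polynomial in \<open>|\<pi>|\<close> and \<open>t\<close>. The leading bit of the output
  tells whether \<open>M(w)\<close> has halted. As usual, describing an input for a fixed machine costs only
  a constant number of bits more than the input itself.
\<close>

definition universal_machine :: "nat \<Rightarrow> nat \<Rightarrow> tm \<Rightarrow> bool" where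
  "universal_machine k l U \<longleftrightarrow> tm_tapes l U \<and>
     (\<exists>(decode :: bool list \<Rightarrow> (tm \<times> bool list) option) (p :: nat poly).
        (\<forall>\<pi> M w. decode \<pi> = Some (M, w) \<longrightarrow> tm_tapes k M) \<and>
        (\<forall>M. tm_tapes k M \<longrightarrow>
           (\<exists>c. \<forall>w. \<exists>\<pi>. decode \<pi> = Some (M, w) \<and> length \<pi> \<le> length w + c)) \<and>
        (\<forall>\<pi> t. tm_result l U (unary_pair t \<pi>) (poly p (length \<pi> + t)) =
           Some (case Option.bind (decode \<pi>) (\<lambda>(M, w). tm_result k M w t) of
                   None \<Rightarrow> [False]
                 | Some y \<Rightarrow> True # y)))"

definition emulated_output :: "nat \<Rightarrow> tm \<Rightarrow> bool list \<Rightarrow> nat \<Rightarrow> bool list \<Rightarrow> bool" where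
  "emulated_output l U \<pi> t y \<longleftrightarrow> (\<exists>s. tm_result l U (unary_pair t \<pi>) s = Some (True # y))"

definition Kt :: "nat \<Rightarrow> tm \<Rightarrow> (nat \<Rightarrow> nat) \<Rightarrow> bool list \<Rightarrow> nat" where
  "Kt l U t x = Inf {length \<pi> | \<pi>. emulated_output l U \<pi> (t (length x)) x}"


section \<open>Average-case hardness of approximation\<close>

definition unif :: "nat \<Rightarrow> bool list pmf" where
  "unif n = pmf_of_set {x. length x = n}"

text \<open>Numbers are output in binary, least significant bit first.\<close>

definition bits_nat :: "bool list \<Rightarrow> nat" where
  "bits_nat bs = horner_sum of_bool 2 bs"

definition mildly_hard_to_approximate ::
    "(nat \<Rightarrow> real) \<Rightarrow> (bool list \<Rightarrow> nat) \<Rightarrow> bool" where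
  "mildly_hard_to_approximate \<beta> f \<longleftrightarrow>
     (\<exists>p :: real poly. (\<forall>n :: nat. poly p (real n) > 0) \<and>
        (\<forall>H. ppt H \<longrightarrow>
           (\<forall>\<^sub>F n in sequentially.
              measure_pmf.prob (bind_pmf (unif n) (\<lambda>x. map_pmf (\<lambda>h. (x, h)) (H x)))
                {(x, h). \<bar>real (bits_nat h) - real (f x)\<bar> \<le> \<beta> (length x)}
              < 1 - 1 / poly p (real n))))"


section \<open>Conditionally secure entropy-preserving pseudorandom generators\<close>

definition indistinguishable ::
    "(nat \<Rightarrow> real) \<Rightarrow> (nat \<Rightarrow> bool list pmf) \<Rightarrow> (nat \<Rightarrow> bool list pmf) \<Rightarrow> bool" where
  "indistinguishable \<mu> A B \<longleftrightarrow>
     (\<forall>D. ppt_distinguisher D \<longrightarrow>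
        (\<exists>n\<^sub>0. \<forall>n\<ge>n\<^sub>0.
           \<bar>pmf (bind_pmf (A n) (D n)) [True] - pmf (bind_pmf (B n) (D n)) [True]\<bar> < \<mu> n))"

definition shannon_entropy :: "bool list pmf \<Rightarrow> real" where
  "shannon_entropy P = prob_space.entropy (measure_pmf P) 2 (count_space UNIV) (\<lambda>x. x)"

lemma shannon_entropy_finite:
  assumes "finite (set_pmf P)"
  shows "shannon_entropy P = - (\<Sum>x\<in>set_pmf P. pmf P x * log 2 (pmf P x))"
proof -
  interpret information_space "measure_pmf P" 2
    by unfold_locales auto
  have d: "distributed (measure_pmf P) (count_space UNIV) (\<lambda>x. x) (\<lambda>x. ennreal (pmf P x))"
    unfolding distributed_def
    by (auto simp: distr_id2 measure_pmf_eq_density[symmetric])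
  interpret S: sigma_finite_measure "count_space (UNIV :: bool list set)"
    by (rule sigma_finite_measure_count_space)
  have "shannon_entropy P =
      - (\<integral>x. pmf P x * log 2 (pmf P x) \<partial>count_space UNIV)"
    unfolding shannon_entropy_def
    by (rule entropy_distr[OF d]) auto
  also have "(\<integral>x. pmf P x * log 2 (pmf P x) \<partial>count_space UNIV) =
      (\<Sum>x\<in>set_pmf P. pmf P x * log 2 (pmf P x))"
    using assms
    by (intro lebesgue_integral_count_space_finite_support[THEN trans] sum.mono_neutral_left)
       (auto intro: finite_subset[OF _ assms] simp: set_pmf_iff)
  finally show ?thesis .
qed

definition ext_length :: "real \<Rightarrow> nat \<Rightarrow> nat" where
  "ext_length \<gamma> n = n + nat \<lfloor>\<gamma> * log 2 (real n)\<rfloor>"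

definition cond_secure_ep_prg ::
    "(nat \<Rightarrow> real) \<Rightarrow> real \<Rightarrow> (bool list \<Rightarrow> bool list) \<Rightarrow> bool" where
  "cond_secure_ep_prg \<mu> \<gamma> G \<longleftrightarrow>
     poly_time G \<and>
     (\<forall>x. length (G x) = ext_length \<gamma> (length x)) \<and>
     (\<exists>(E :: nat \<Rightarrow> bool list set) (\<alpha> :: real).
        (\<forall>n. E n \<subseteq> {x. length x = n} \<and> E n \<noteq> {}) \<and>
        indistinguishable \<mu>
          (\<lambda>n. map_pmf G (cond_pmf (unif n) (E n)))
          (\<lambda>n. unif (ext_length \<gamma> n)) \<and>
        (\<forall>\<^sub>F n in sequentially.
           shannon_entropy (map_pmf G (cond_pmf (unif n) (E n))) \<ge>
             real n - \<alpha> * log 2 (real n)))"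

end

theory Submission
  imports Defs "HOL-Real_Asymp.Real_Asymp"
begin

text \<open>
  An output of \<open>G\<close> on a seed of length \<open>n\<close> has \<open>K\<^sup>t \<le> n + O(1)\<close>, because the rate-1 machine for \<open>G\<close>
  finishes within the time bound, whereas all but a small constant fraction of the strings of length
  \<open>m = n + \<gamma> log n\<close> have \<open>K\<^sup>t > m - 5\<close>. For \<open>\<gamma> > 2 d\<close> a heuristic that is correct up to \<open>d log n\<close>
  separates the two cases, so comparing its answer with \<open>(n + m) / 2\<close> gives a distinguisher.
  The heuristic is only known to work on uniform inputs. Since \<open>G(U\<^sub>n | E\<^sub>n)\<close> has entropy at least
  \<open>n - \<alpha> log n\<close> and no point of mass less than \<open>2\<^sup>-\<^sup>n\<close>, at least half of its mass is on points of mass at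
  most \<open>n\<^sup>2\<^sup>\<alpha> / 2\<^sup>n\<close>, where it exceeds the uniform distribution by a polynomial factor only; hence
  an inverse polynomial failure probability on uniform inputs remains harmless.

  The lengths \<open>n + \<lfloor>\<gamma> log n\<rfloor>\<close> do not exhaust the natural numbers, but those for \<open>\<gamma>\<close> and those for \<open>2 \<gamma>\<close>
  together contain all large numbers. Using both generators replaces the usual padding argument.
\<close>

section \<open>Probabilistic machines given by transition functions\<close>

text \<open>A transition function given by cases is easier to execute symbolically than an
  association list; \<open>fn_table\<close> turns it into a genuine machine later.\<close>

definition fn_step :: "(nat \<Rightarrow> symbol list \<Rightarrow> (action \<times> action) option) \<Rightarrow> config \<Rightarrow> config pmf" where
  "fn_step \<delta> c =
     (case \<delta> (fst c) (map tape_read (snd c)) of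
        None \<Rightarrow> return_pmf c
      | Some (a, b) \<Rightarrow>
          map_pmf (\<lambda>coin. perform (if coin then a else b) c) (bernoulli_pmf (1 / 2)))"

primrec fn_run :: "(nat \<Rightarrow> symbol list \<Rightarrow> (action \<times> action) option) \<Rightarrow> nat \<Rightarrow> config \<Rightarrow> config pmf" where
  "fn_run \<delta> 0 c = return_pmf c"
| "fn_run \<delta> (Suc t) c = bind_pmf (fn_step \<delta> c) (fn_run \<delta> t)"

definition fn_halted :: "(nat \<Rightarrow> symbol list \<Rightarrow> (action \<times> action) option) \<Rightarrow> config \<Rightarrow> bool" where
  "fn_halted \<delta> c \<longleftrightarrow> \<delta> (fst c) (map tape_read (snd c)) = None"

text \<open>Here \<open>t\<close> is an upper bound on the halting time, since a halted
  configuration stays put. The rules below pass from the next configuration to the current one, so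
  runs are assembled backwards: each phase takes the rest of the computation as a premise.\<close>

definition yields ::
    "(nat \<Rightarrow> symbol list \<Rightarrow> (action \<times> action) option) \<Rightarrow> nat \<Rightarrow> config \<Rightarrow> bool list pmf \<Rightarrow> bool" where
  "yields \<delta> t c P \<longleftrightarrow>
     (\<forall>c' \<in> set_pmf (fn_run \<delta> t c). fn_halted \<delta> c') \<and> map_pmf tm_output (fn_run \<delta> t c) = P"

lemma entry_conv: "entry M c = map_of M (fst c, map tape_read (snd c))"
  by (cases c) simp

lemma perform_conv: "perform a c = (fst a, map2 tape_act (snd a) (snd c))"
  by (cases a; cases c) simp

lemma ptm_run_eq_fn_run: "ptm_run M t c = fn_run (\<lambda>q ss. map_of M (q, ss)) t c"
proof -
  have "ptm_step M = fn_step (\<lambda>q ss. map_of M (q, ss))"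
    by (rule ext) (simp add: ptm_step_def fn_step_def entry_conv)
  then show ?thesis
    by (induction t arbitrary: c) (auto intro!: bind_pmf_cong)
qed

lemma fn_run_halted: "fn_halted \<delta> c \<Longrightarrow> fn_run \<delta> t c = return_pmf c"
  by (induction t) (simp_all add: fn_halted_def fn_step_def bind_return_pmf)

lemma fn_run_add: "fn_run \<delta> (s + t) c = bind_pmf (fn_run \<delta> s c) (fn_run \<delta> t)"
  by (induction s arbitrary: c) (auto simp: bind_return_pmf bind_assoc_pmf intro!: bind_pmf_cong)

lemma yields_mono:
  assumes "yields \<delta> s c P" "s \<le> t"
  shows "yields \<delta> t c P"
proof -
  obtain r where "t = s + r"
    using assms(2) le_Suc_ex by blast
  have "bind_pmf (fn_run \<delta> s c) (fn_run \<delta> r) = bind_pmf (fn_run \<delta> s c) return_pmf"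
    using assms(1) by (intro bind_pmf_cong) (auto simp: yields_def fn_run_halted)
  then show ?thesis
    using assms(1) \<open>t = s + r\<close> by (simp add: yields_def fn_run_add bind_return_pmf')
qed

lemma yields_halted:
  assumes "fn_halted \<delta> c" "P = return_pmf (tm_output c)"
  shows "yields \<delta> t c P"
  using assms by (simp add: yields_def fn_run_halted)

lemma yields_step:
  assumes "\<delta> (fst c) (map tape_read (snd c)) = Some (a, a)" "yields \<delta> t (perform a c) P"
  shows "yields \<delta> (Suc t) c P"
proof -
  have "fn_step \<delta> c = return_pmf (perform a c)"
    by (simp add: fn_step_def assms(1) map_pmf_def[symmetric])
  then show ?thesis
    using assms(2) by (simp add: yields_def bind_return_pmf)
qed

lemma yields_coin:
  assumes "\<delta> (fst c) (map tape_read (snd c)) = Some (a, b)"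
    and "\<And>coin. yields \<delta> t (perform (if coin then a else b) c) (P coin)"
  shows "yields \<delta> (Suc t) c (bind_pmf (bernoulli_pmf (1 / 2)) P)"
  using assms
  by (auto simp: yields_def fn_step_def bind_map_pmf map_bind_pmf intro!: bind_pmf_cong)

section \<open>Finite tables for transition functions\<close>

definition fn_table ::
    "nat \<Rightarrow> symbol list \<Rightarrow> nat \<Rightarrow> (nat \<Rightarrow> symbol list \<Rightarrow> (action \<times> action) option) \<Rightarrow> ptm" where
  "fn_table k S Q \<delta> = concat (map (\<lambda>key. case \<delta> (fst key) (snd key) of None \<Rightarrow> [] | Some a \<Rightarrow> [(key, a)])
     (List.product [0..<Q] (List.n_lists k S)))"

lemma map_of_concat_option:
  "map_of (concat (map (\<lambda>x. case f x of None \<Rightarrow> [] | Some a \<Rightarrow> [(x, a)]) xs)) y =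
     (if y \<in> set xs then f y else None)"
  by (induction xs) (auto split: option.splits)

lemma map_of_fn_table:
  assumes "q < Q" "set ss \<subseteq> set S" "length ss = k"
  shows "map_of (fn_table k S Q \<delta>) (q, ss) = \<delta> q ss"
  unfolding fn_table_def using assms
  by (subst map_of_concat_option) (auto simp: set_n_lists)

text \<open>The table covers only states below \<open>Q\<close> and symbols from \<open>S\<close>,
  so it agrees with \<open>\<delta>\<close> as long as the configuration stays in this
  range.\<close>

definition fits :: "nat \<Rightarrow> symbol list \<Rightarrow> nat \<Rightarrow> config \<Rightarrow> bool" where
  "fits k S Q c \<longleftrightarrow> fst c < Q \<and> length (snd c) = k \<and> (\<forall>tp \<in> set (snd c). range (snd tp) \<subseteq> set S)"

definition act_fits :: "nat \<Rightarrow> symbol list \<Rightarrow> nat \<Rightarrow> action \<Rightarrow> bool" where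
  "act_fits k S Q a \<longleftrightarrow> fst a < Q \<and> length (snd a) = k \<and> fst ` set (snd a) \<subseteq> set S"

definition closed_fn ::
    "nat \<Rightarrow> symbol list \<Rightarrow> nat \<Rightarrow> (nat \<Rightarrow> symbol list \<Rightarrow> (action \<times> action) option) \<Rightarrow> bool" where
  "closed_fn k S Q \<delta> \<longleftrightarrow>
     (\<forall>q ss a b. q < Q \<longrightarrow> set ss \<subseteq> set S \<longrightarrow> length ss = k \<longrightarrow> \<delta> q ss = Some (a, b) \<longrightarrow>
        act_fits k S Q a \<and> act_fits k S Q b)"

lemma fits_perform:
  assumes "fits k S Q c" "act_fits k S Q a"
  shows "fits k S Q (perform a c)"
proof -
  have "range (snd (tape_act x tp)) \<subseteq> set S"
    if "(x, tp) \<in> set (zip (snd a) (snd c))" for x tp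
  proof -
    have "range (snd tp) \<subseteq> set S" "fst x \<in> set S"
      using that assms set_zip_rightD[OF that] set_zip_leftD[OF that]
      by (auto simp: fits_def act_fits_def)
    then show ?thesis
      by (cases x; cases tp) auto
  qed
  then show ?thesis
    using assms unfolding fits_def act_fits_def perform_conv by (simp add: split_beta)
qed

lemma fits_read:
  assumes "fits k S Q c"
  shows "set (map tape_read (snd c)) \<subseteq> set S"
proof
  fix s assume "s \<in> set (map tape_read (snd c))"
  then obtain tp where "tp \<in> set (snd c)" "s = tape_read tp" by (auto simp only: set_map)
  moreover have "tape_read tp \<in> range (snd tp)" by (cases tp) simp
  ultimately show "s \<in> set S"
    using assms unfolding fits_def by blast
qed

lemma fits_entry:
  assumes "fits k S Q c"
  shows "entry (fn_table k S Q \<delta>) c = \<delta> (fst c) (map tape_read (snd c))"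
  unfolding entry_conv using assms fits_read[OF assms]
  by (intro map_of_fn_table) (auto simp: fits_def)

text \<open>Closure preserves \<open>fits\<close> from step to step, so every lookup agrees with
  \<open>\<delta>\<close>. That the final configurations fit as well transfers the halting
  condition.\<close>

lemma fn_table_run:
  assumes "closed_fn k S Q \<delta>" "fits k S Q c"
  shows "ptm_run (fn_table k S Q \<delta>) t c = fn_run \<delta> t c \<and>
         (\<forall>c' \<in> set_pmf (fn_run \<delta> t c). fits k S Q c')"
  using assms(2)
proof (induction t arbitrary: c)
  case 0
  then show ?case by simp
next
  case (Suc t)
  have step: "ptm_step (fn_table k S Q \<delta>) c = fn_step \<delta> c"
    by (simp add: ptm_step_def fn_step_def fits_entry[OF Suc.prems])
  have fits: "fits k S Q c'" if "c' \<in> set_pmf (fn_step \<delta> c)" for c'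
  proof (cases "\<delta> (fst c) (map tape_read (snd c))")
    case None
    then show ?thesis using that Suc.prems by (simp add: fn_step_def)
  next
    case (Some ab)
    obtain a b where ab: "ab = (a, b)" by (cases ab)
    have "act_fits k S Q a \<and> act_fits k S Q b"
      using assms(1) Suc.prems fits_read[OF Suc.prems] Some ab
      unfolding closed_fn_def fits_def by (metis length_map)
    then show ?thesis
      using that Some ab Suc.prems by (auto simp: fn_step_def intro: fits_perform split: if_splits)
  qed
  show ?case
    using Suc.IH[OF fits] by (auto simp: step intro!: bind_pmf_cong)
qed

lemma fn_table_result:
  assumes "closed_fn k S Q \<delta>" "fits k S Q (init k x)" "yields \<delta> t (init k x) P"
  shows "ptm_result_within k (fn_table k S Q \<delta>) x t P"
  using fn_table_run[OF assms(1,2), of t] assms(3)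
  by (auto simp: ptm_result_within_def yields_def fn_halted_def fits_entry)

lemma fn_table_tapes:
  assumes "closed_fn k S Q \<delta>" "k \<ge> 1"
  shows "ptm_tapes k (fn_table k S Q \<delta>)"
  unfolding ptm_tapes_def
proof (intro conjI ballI)
  fix e assume "e \<in> set (fn_table k S Q \<delta>)"
  then obtain q ss a b where e: "e = ((q, ss), (a, b))"
    and "q < Q" "set ss \<subseteq> set S" "length ss = k" "\<delta> q ss = Some (a, b)"
    by (auto simp: fn_table_def set_n_lists split: option.splits)
  then have "length ss = k" "length (snd a) = k" "length (snd b) = k"
    using assms(1) unfolding closed_fn_def act_fits_def by blast+
  then show "case e of (x, xa) \<Rightarrow> (case x of (q, ss) \<Rightarrow> \<lambda>((q0, as0), q1, as1).
      length ss = k \<and> length as0 = k \<and> length as1 = k) xa"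
    by (simp add: e split_beta)
qed (rule assms(2))

section \<open>The threshold distinguisher\<close>

definition input_tape :: "bool list \<Rightarrow> int \<Rightarrow> symbol" where
  "input_tape x = (\<lambda>i. if 0 \<le> i \<and> nat i < length x then Bit (x ! nat i) else Blank)"

text \<open>This fixes exactly the cells that \<open>tape_bits\<close> inspects; cells left of 0 and
  beyond the first non-bit are free.\<close>

definition holds_bits :: "(int \<Rightarrow> symbol) \<Rightarrow> bool list \<Rightarrow> bool" where
  "holds_bits x bs \<longleftrightarrow>
     (\<forall>i < length bs. x (int i) = Bit (bs ! i)) \<and> \<not> is_Bit (x (int (length bs)))"

lemma tape_bits_eq:
  assumes "holds_bits x bs"
  shows "tape_bits (h, x) = bs"
proof -
  have "(LEAST j. \<not> is_Bit (x (int j))) = length bs"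
    using assms by (intro Least_equality) (auto simp: holds_bits_def not_less[symmetric])
  then show ?thesis
    using assms by (auto simp: tape_bits_def holds_bits_def intro!: nth_equalityI)
qed

text \<open>Without a non-bit cell the \<open>LEAST\<close> in \<open>tape_bits\<close> would be
  unspecified; the position of such a cell also bounds the length of the output.\<close>

lemma holds_bits_tape_bits:
  assumes "\<not> is_Bit (x (int j))"
  shows "holds_bits x (tape_bits (h, x))" "length (tape_bits (h, x)) \<le> j"
proof -
  define L where "L = (LEAST j. \<not> is_Bit (x (int j)))"
  have 1: "\<not> is_Bit (x (int L))" "L \<le> j"
    unfolding L_def using assms by (rule LeastI, intro Least_le)
  have 2: "is_Bit (x (int i))" if "i < L" for i
    using not_less_Least[of i] that unfolding L_def by blast
  show "holds_bits x (tape_bits (h, x))" "length (tape_bits (h, x)) \<le> j"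
    using 1 2 by (auto simp: tape_bits_def holds_bits_def L_def[symmetric])
qed

lemma holds_bits_input_tape: "holds_bits (input_tape x) x"
  by (auto simp: holds_bits_def input_tape_def)

lemma init_conv: "init (Suc k) x = (0, (0, input_tape x) # replicate k (0, \<lambda>_. Blank))"
  by (simp add: init_def input_tape_def)

lemma tm_output_init: "tm_output (init k x) = x"
  using tape_bits_eq[OF holds_bits_input_tape] by (simp add: tm_output_def init_def input_tape_def)

fun move_code :: "move \<Rightarrow> symbol" where
  "move_code Left = Work 0"
| "move_code Stay = Work 1"
| "move_code Right = Work 2"

text \<open>The result is the inverse of the recorded move. Symbols that encode no move give
  \<open>None\<close>, so a blank or a bit marks the bottom of the record.\<close>

definition undo_move :: "symbol \<Rightarrow> move option" where
  "undo_move s =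
     (if s = Work 0 then Some Right else if s = Work 1 then Some Stay
      else if s = Work 2 then Some Left else None)"

definition displacement :: "symbol \<Rightarrow> int" where
  "displacement s = (if s = Work 0 then - 1 else if s = Work 2 then 1 else 0)"

lemma undo_move_code: "undo_move (move_code m) \<noteq> None"
  by (cases m) (auto simp: undo_move_def)

lemma move_head_code: "move_head m h = h + displacement (move_code m)"
  by (cases m) (auto simp: displacement_def)

lemma undo_move_displacement: "undo_move s = Some m \<Longrightarrow> move_head m h = h - displacement s"
  by (auto simp: undo_move_def displacement_def split: if_splits)

definition det_act ::
    "nat \<Rightarrow> symbol \<times> move \<Rightarrow> symbol \<times> move \<Rightarrow> symbol \<times> move \<Rightarrow> symbol list \<Rightarrow> (action \<times> action) option" where
  "det_act q i a x ss =
     (let act = (q, i # a # x # map (\<lambda>s. (s, Stay)) ss) in Some (act, act))"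

definition sim_act :: "symbol \<Rightarrow> action \<Rightarrow> action" where
  "sim_act i c = (10 + fst c, (i, Stay) # (move_code (snd (hd (snd c))), Right) # snd c)"

text \<open>
  Given a machine \<open>M\<close> for the heuristic, \<open>dist_fn M\<close> works on the input tape, an auxiliary tape and the
  tapes of \<open>M\<close>; \<open>i\<close>, \<open>a\<close> and \<open>x\<close> are the symbols on the first two of these and on the first tape of \<open>M\<close>.
  \<^item> States 0 to 2 read \<open>1\<^sup>n\<close>, erase cell 1 of the input tape, which makes \<open>[True]\<close> the default output,
    and put \<open>n - 2\<close> marks on the auxiliary tape.
  \<^item> States 3 and 4 copy \<open>y\<close> to the first tape of \<open>M\<close>. Every mark pays for two bits, and the machine halts
    when the marks run out: the running time must be polynomial in \<open>n\<close> whatever the length of \<open>y\<close>.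
  \<^item> State 5 rewinds the first tape of \<open>M\<close>, and state \<open>10 + q\<close> simulates state \<open>q\<close> of \<open>M\<close>. The moves on the first
    tape of \<open>M\<close> are recorded on the auxiliary tape, for otherwise cell 0, where the output of \<open>M\<close>
    starts, could not be found again.
  \<^item> State 6 undoes the recorded moves.
  \<^item> State 7 decrements the binary number on the first tape of \<open>M\<close>, again recording its moves. States 7 and
    8 move the input head two cells to the left for each decrement. If the number underflows first, the
    machine halts with output \<open>[True]\<close>; if the input head reaches cell 1 first, that cell is restored
    and the output is the whole input.
\<close>

fun dist_fn :: "ptm \<Rightarrow> nat \<Rightarrow> symbol list \<Rightarrow> (action \<times> action) option" where
  "dist_fn M q (i # a # x # ss) =
    (if q = 0 then
       (if i = Bit True then det_act 1 (i, Right) (a, Stay) (x, Stay) ss else None)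
     else if q = 1 then
       (if i = Bit True then det_act 2 (Blank, Right) (a, Stay) (x, Stay) ss else None)
     else if q = 2 then
       (if i = Bit True then det_act 2 (i, Right) (Bit True, Right) (x, Stay) ss
        else if i = Bit False then det_act 3 (i, Right) (a, Left) (x, Stay) ss else None)
     else if q = 3 then
       (if is_Bit i then (if is_Bit a then det_act 4 (i, Right) (a, Stay) (i, Right) ss else None)
        else det_act 5 (i, Left) (a, Stay) (x, Left) ss)
     else if q = 4 then
       (if is_Bit i then det_act 3 (i, Right) (a, Left) (i, Right) ss
        else det_act 5 (i, Left) (a, Stay) (x, Left) ss)
     else if q = 5 then
       (if is_Bit x then det_act 5 (i, Stay) (a, Stay) (x, Left) ss
        else det_act 10 (i, Stay) (a, Stay) (x, Right) ss)
     else if q = 6 then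
       (case undo_move a of
          Some m \<Rightarrow> det_act 6 (i, Stay) (a, Left) (x, m) ss
        | None \<Rightarrow> det_act 7 (i, Stay) (a, Right) (x, Stay) ss)
     else if q = 7 then
       (if x = Bit False then det_act 7 (i, Stay) (Work 2, Right) (Bit True, Right) ss
        else if x = Bit True then
          (if is_Bit i then det_act 8 (i, Left) (a, Left) (Bit False, Stay) ss
           else det_act 9 (Bit True, Stay) (a, Stay) (x, Stay) ss)
        else None)
     else if q = 8 then
       (if is_Bit i then det_act 6 (i, Left) (a, Stay) (x, Stay) ss
        else det_act 9 (Bit True, Stay) (a, Stay) (x, Stay) ss)
     else if q = 9 then None
     else
       (case map_of M (q - 10, x # ss) of
          None \<Rightarrow> det_act 6 (i, Stay) (a, Left) (x, Stay) ss
        | Some (c, c') \<Rightarrow> Some (sim_act i c, sim_act i c')))"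
| "dist_fn M q _ = None"

section \<open>Executing the distinguisher: undoing moves and comparing numbers\<close>

lemma map2_keep: "map2 tape_act (map ((\<lambda>s. (s, Stay)) \<circ> tape_read) ts) ts = ts"
  by (induction ts) auto

lemma tape_act_keep [simp]: "tape_act (tape_read tp, Stay) tp = tp"
  by (cases tp) simp

lemma yields_det:
  assumes "dist_fn M q (tape_read I # tape_read A # tape_read X # map tape_read ts) =
      det_act q' i a x (map tape_read ts)"
    and "yields (dist_fn M) t (q', tape_act i I # tape_act a A # tape_act x X # ts) P"
  shows "yields (dist_fn M) (Suc t) (q, I # A # X # ts) P"
  by (rule yields_step[where a = "(q', i # a # x # map (\<lambda>s. (s, Stay)) (map tape_read ts))"])
    (use assms in \<open>simp_all add: det_act_def Let_def perform_conv map2_keep del: dist_fn.simps\<close>)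

text \<open>The record is a stack in the \<open>r\<close> cells from \<open>p\<close> on. Popping it
  shifts the head back by the recorded displacements, hence to cell 0; the symbol in cell
  \<open>p - 1\<close> ends the loop, and one more step enters state 7.\<close>

lemma dist_unwind:
  assumes "undo_move (a (p - 1)) = None" "\<And>i. i < r \<Longrightarrow> undo_move (a (p + int i)) \<noteq> None"
    and "yields (dist_fn M) t (7, I # (p, a) # (0, x) # ts) P"
  shows "yields (dist_fn M) (t + r + 1)
    (6, I # (p + int r - 1, a) # (\<Sum>i<r. displacement (a (p + int i)), x) # ts) P"
  using assms(2)
proof (induction r)
  case 0
  show ?case
    using assms(1,3) by (auto intro!: yields_det)
next
  case (Suc r)
  obtain m where m: "undo_move (a (p + int r)) = Some m"
    using Suc.prems[of r] by auto
  have "yields (dist_fn M) (t + r + 1)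
      (6, I # (p + int r - 1, a) # (\<Sum>i<r. displacement (a (p + int i)), x) # ts) P"
    using Suc.prems by (intro Suc.IH) simp
  then have "yields (dist_fn M) (Suc (t + r + 1))
      (6, I # (p + int r, a) #
         ((\<Sum>i<r. displacement (a (p + int i))) + displacement (a (p + int r)), x) # ts) P"
    using m by - (rule yields_det, auto simp: undo_move_displacement)
  then show ?case by (simp add: algebra_simps)
qed

text \<open>The borrow turns \<open>z\<close> low-order zeros into ones while moving right. Each
  step is recorded as a move to the right, so that unwinding leads back to cell 0.\<close>

lemma dist_decrement_zeros:
  assumes "\<And>j. j < z \<Longrightarrow> x (i + int j) = Bit False"
    and "yields (dist_fn M) t (7, I # (p + int z, \<lambda>j. if p \<le> j \<and> j < p + int z then Work 2 else a j) #
      (i + int z, \<lambda>j. if i \<le> j \<and> j < i + int z then Bit True else x j) # ts) P"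
  shows "yields (dist_fn M) (t + z) (7, I # (p, a) # (i, x) # ts) P"
  using assms
proof (induction z arbitrary: p i a x)
  case 0
  then show ?case by (simp flip: not_le)
next
  case (Suc z)
  have "yields (dist_fn M) (t + z) (7, I # (p + 1, a(p := Work 2)) # (i + 1, x(i := Bit True)) # ts) P"
  proof (rule Suc.IH)
    fix j assume "j < z"
    then show "(x(i := Bit True)) (i + 1 + int j) = Bit False"
      using Suc.prems(1)[of "Suc j"] by (simp add: algebra_simps)
  next
    have "(\<lambda>j. if p + 1 \<le> j \<and> j < p + 1 + int z then Work 2 else (a(p := Work 2)) j) =
        (\<lambda>j. if p \<le> j \<and> j < p + int (Suc z) then Work 2 else a j)"
      "(\<lambda>j. if i + 1 \<le> j \<and> j < i + 1 + int z then Bit True else (x(i := Bit True)) j) =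
        (\<lambda>j. if i \<le> j \<and> j < i + int (Suc z) then Bit True else x j)"
      by auto
    then show "yields (dist_fn M) t (7, I # (p + 1 + int z,
        \<lambda>j. if p + 1 \<le> j \<and> j < p + 1 + int z then Work 2 else (a(p := Work 2)) j) #
        (i + 1 + int z, \<lambda>j. if i + 1 \<le> j \<and> j < i + 1 + int z then Bit True else (x(i := Bit True)) j) # ts) P"
      using Suc.prems(2) by (simp add: algebra_simps)
  qed
  moreover have "x i = Bit False"
    using Suc.prems(1)[of 0] by simp
  ultimately show ?case
    by (auto intro!: yields_det)
qed

lemma bits_nat_Cons: "bits_nat (b # bs) = of_bool b + 2 * bits_nat bs"
  by (simp add: bits_nat_def)

lemma bits_nat_eq_0: "bits_nat bs = 0 \<Longrightarrow> i < length bs \<Longrightarrow> \<not> bs ! i"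
  by (induction bs arbitrary: i) (auto simp: bits_nat_Cons nth_Cons split: nat.splits)

text \<open>This is the borrow pattern of binary decrement: the borrow stops at the lowest one, and
  the number of bits is kept.\<close>

lemma bits_nat_eq_Suc:
  assumes "bits_nat bs = Suc v"
  obtains z bs' where "bs = replicate z False @ True # bs'"
    "bits_nat (replicate z True @ False # bs') = v"
proof -
  have "\<exists>z bs'. bs = replicate z False @ True # bs' \<and> bits_nat (replicate z True @ False # bs') = v"
    using assms
  proof (induction bs arbitrary: v)
    case Nil
    then show ?case by (simp add: bits_nat_def)
  next
    case (Cons b bs)
    show ?case
    proof (cases b)
      case True
      then have "b # bs = replicate 0 False @ True # bs \<and> bits_nat (replicate 0 True @ False # bs) = v"
        using Cons.prems by (simp add: bits_nat_Cons)
      then show ?thesis by blast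
    next
      case False
      then obtain w where w: "bits_nat bs = Suc w" "v = Suc (2 * w)"
        using Cons.prems by (cases "bits_nat bs") (auto simp: bits_nat_Cons)
      obtain z bs' where "bs = replicate z False @ True # bs'" "bits_nat (replicate z True @ False # bs') = w"
        using Cons.IH[OF w(1)] by blast
      then have "b # bs = replicate (Suc z) False @ True # bs' \<and>
          bits_nat (replicate (Suc z) True @ False # bs') = v"
        using False w by (simp add: bits_nat_Cons)
      then show ?thesis by blast
    qed
  qed
  then show thesis using that by blast
qed

definition marked_input :: "nat \<Rightarrow> bool list \<Rightarrow> int \<Rightarrow> symbol" where
  "marked_input n y = (input_tape (unary_pair n y))(1 := Blank)"

lemma marked_input_simps:
  assumes "n \<ge> 2"
  shows "marked_input n y 0 = Bit True" "marked_input n y 1 = Blank"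
    "2 \<le> i \<Longrightarrow> i < int n \<Longrightarrow> marked_input n y i = Bit True"
    "marked_input n y (int n) = Bit False"
    "j < length y \<Longrightarrow> marked_input n y (int n + 1 + int j) = Bit (y ! j)"
    "marked_input n y (int n + 1 + int (length y)) = Blank"
    "2 \<le> i \<Longrightarrow> i \<le> int (n + length y) \<Longrightarrow> is_Bit (marked_input n y i)"
  using assms
  by (auto simp: marked_input_def input_tape_def unary_pair_def nth_append nat_add_distrib)

lemma output_marked_input:
  assumes "n \<ge> 2"
  shows "tape_bits (h, marked_input n y) = [True]"
    "tape_bits (h, (marked_input n y)(1 := Bit True)) = unary_pair n y"
proof -
  show "tape_bits (h, marked_input n y) = [True]"
    using marked_input_simps[OF assms] by (intro tape_bits_eq) (simp add: holds_bits_def)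
  have "(marked_input n y)(1 := Bit True) = input_tape (unary_pair n y)"
    using assms by (auto simp: marked_input_def input_tape_def unary_pair_def nth_append)
  then show "tape_bits (h, (marked_input n y)(1 := Bit True)) = unary_pair n y"
    by (simp add: tape_bits_eq[OF holds_bits_input_tape])
qed

text \<open>The input head is \<open>r\<close> moves away from the blank in cell 1 and each
  decrement uses two of them, so underflow comes first exactly when twice the number is at most
  \<open>r\<close>. A round keeps the number of bits and takes at most
  \<open>2 * length bs + 6\<close> steps.\<close>

lemma dist_compare:
  assumes n: "n \<ge> 2"
    and "r \<le> n + length y - 1" "holds_bits x bs" "undo_move (a (p - 1)) = None"
  shows "yields (dist_fn M) ((r + 1) * (2 * length bs + 6))
    (7, (int r + 1, marked_input n y) # (p, a) # (0, x) # ts)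
    (return_pmf (if 2 * bits_nat bs \<le> r then [True] else unary_pair n y))"
  using assms(2-)
proof (induction r arbitrary: x bs a rule: less_induct)
  case (less r)
  note mi = marked_input_simps[OF n]
  show ?case
  proof (cases "bits_nat bs")
    case 0
    \<comment> \<open>All bits are zero: the borrow runs off the end of the number and the machine
      halts with output \<open>[True]\<close>.\<close>
    have 1: "x (0 + int j) = Bit False" if "j < length bs" for j
      using less.prems(2) bits_nat_eq_0[OF 0 that] that by (simp add: holds_bits_def)
    have "yields (dist_fn M) (0 + length bs) (7, (int r + 1, marked_input n y) # (p, a) # (0, x) # ts)
        (return_pmf [True])"
      by (rule dist_decrement_zeros[where x = x and i = 0, OF 1], assumption, rule yields_halted)
        (use less.prems(2) output_marked_input(1)[OF n] in
          \<open>auto simp: fn_halted_def holds_bits_def tm_output_def\<close>)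
    then show ?thesis
      using 0 by (auto elim!: yields_mono)
  next
    case (Suc v)
    then obtain z bs' where bs: "bs = replicate z False @ True # bs'"
      and v: "bits_nat (replicate z True @ False # bs') = v"
      by (rule bits_nat_eq_Suc)
    have 1: "x (0 + int j) = Bit False" if "j < z" for j
      using less.prems(2) that bs by (auto simp: holds_bits_def nth_append)
    have xz: "x (int z) = Bit True"
      using less.prems(2) bs by (auto simp: holds_bits_def nth_append)
    define a' where "a' = (\<lambda>j. if p \<le> j \<and> j < p + int z then Work 2 else a j)"
    define x' where "x' = (\<lambda>j. if 0 \<le> j \<and> j < 0 + int z then Bit True else x j)"
    have x'z: "x' (int z) = Bit True"
      using xz by (simp add: x'_def)
    show ?thesis
    proof (cases "2 \<le> r")
      case False
      \<comment> \<open>Fewer than two moves remain and the number is positive, so the blank in cell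
        1 is met: at once if \<open>r = 0\<close>, in state 8 if \<open>r = 1\<close>.\<close>
      have out: "yields (dist_fn M) 0 (9, (1, (marked_input n y)(1 := Bit True)) # A # X # ts)
          (return_pmf (unary_pair n y))" for A X
        by (rule yields_halted) (use output_marked_input(2)[OF n] in
          \<open>auto simp: fn_halted_def tm_output_def\<close>)
      have "yields (dist_fn M) 2 (7, (int r + 1, marked_input n y) # (p + int z, a') # (int z, x') # ts)
          (return_pmf (unary_pair n y))"
      proof (cases "r = 0")
        case True
        have "yields (dist_fn M) (Suc 0) (7, (int r + 1, marked_input n y) # (p + int z, a') # (int z, x') # ts)
          (return_pmf (unary_pair n y))"
          using x'z mi(2) True by (auto intro!: yields_det out)
        then show ?thesis by (rule yields_mono) simp
      next
        case r: False
        then have "r = 1" using False by simp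
        have "is_Bit (marked_input n y 2)"
          using \<open>r = 1\<close> less.prems(1) by (intro mi(7)) auto
        then have "yields (dist_fn M) (Suc (Suc 0)) (7, (int r + 1, marked_input n y) # (p + int z, a') # (int z, x') # ts)
          (return_pmf (unary_pair n y))"
          using x'z mi(2) \<open>r = 1\<close> by (auto intro!: yields_det out)
        then show ?thesis by (simp add: numeral_2_eq_2)
      qed
      then have "yields (dist_fn M) (2 + z) (7, (int r + 1, marked_input n y) # (p, a) # (0, x) # ts)
          (return_pmf (unary_pair n y))"
        unfolding a'_def x'_def by (intro dist_decrement_zeros[where x = x and i = 0, OF 1]) simp_all
      moreover have "2 + z \<le> (r + 1) * (2 * length bs + 6)"
        by (simp add: bs)
      ultimately show ?thesis
        using Suc False by (auto elim!: yields_mono)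
    next
      case True
      \<comment> \<open>The decremented number, to which the induction hypothesis applies with
        \<open>r - 2\<close>.\<close>
      define bs2 where "bs2 = replicate z True @ False # bs'"
      define R where "R = (if 2 * bits_nat bs2 \<le> r - 2 then [True] else unary_pair n y)"
      have len: "length bs2 = length bs" "z < length bs"
        by (simp_all add: bs bs2_def)
      have h1: "holds_bits (x'(int z := Bit False)) bs2"
        using less.prems(2) by (auto simp: holds_bits_def bs bs2_def x'_def nth_append)
      have h2: "undo_move (a' (p - 1)) = None"
        using less.prems(3) by (simp add: a'_def)
      have "yields (dist_fn M) ((r - 2 + 1) * (2 * length bs2 + 6))
          (7, (int (r - 2) + 1, marked_input n y) # (p, a') # (0, x'(int z := Bit False)) # ts) (return_pmf R)"
        unfolding R_def using less.prems(1) True by (intro less.IH[where a = a', OF _ _ h1 h2]) simp_all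
      then have "yields (dist_fn M) ((r - 2 + 1) * (2 * length bs2 + 6) + z + 1)
          (6, (int (r - 2) + 1, marked_input n y) # (p + int z - 1, a') #
             (\<Sum>i<z. displacement (a' (p + int i)), x'(int z := Bit False)) # ts) (return_pmf R)"
        using less.prems(3) by (intro dist_unwind) (auto simp: a'_def undo_move_def)
      moreover have "(\<Sum>i<z. displacement (a' (p + int i))) = int z"
        by (simp add: a'_def displacement_def)
      moreover have "int (r - 2) + 1 = int r - 1" using True by simp
      ultimately have "yields (dist_fn M) ((r - 2 + 1) * (2 * length bs2 + 6) + z + 1)
          (6, (int r - 1, marked_input n y) # (p + int z - 1, a') #
             (int z, x'(int z := Bit False)) # ts) (return_pmf R)"
        by simp
      moreover have "yields (dist_fn M) (Suc (Suc t))
          (7, (int r + 1, marked_input n y) # (p + int z, a') # (int z, x') # ts) (return_pmf R)"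
        if "yields (dist_fn M) t (6, (int r - 1, marked_input n y) # (p + int z - 1, a') #
             (int z, x'(int z := Bit False)) # ts) (return_pmf R)" for t
      proof -
        have "is_Bit (marked_input n y (int r))" "is_Bit (marked_input n y (int r + 1))"
          using True less.prems(1) n by (auto intro!: mi(7))
        then show ?thesis
          using x'z that by (auto intro!: yields_det)
      qed
      ultimately have "yields (dist_fn M) (Suc (Suc ((r - 2 + 1) * (2 * length bs2 + 6) + z + 1)))
          (7, (int r + 1, marked_input n y) # (p + int z, a') # (int z, x') # ts) (return_pmf R)"
        by blast
      then have "yields (dist_fn M) (Suc (Suc ((r - 2 + 1) * (2 * length bs2 + 6) + z + 1)) + z)
          (7, (int r + 1, marked_input n y) # (p, a) # (0, x) # ts) (return_pmf R)"
        unfolding a'_def x'_def by (intro dist_decrement_zeros[where x = x and i = 0, OF 1]) simp_all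
      moreover have "Suc (Suc ((r - 2 + 1) * (2 * length bs2 + 6) + z + 1)) + z
          \<le> (r + 1) * (2 * length bs + 6)"
      proof -
        obtain s where "r = Suc (Suc s)"
          using True by (metis add_2_eq_Suc le_Suc_ex)
        then show ?thesis using len by (simp add: algebra_simps)
      qed
      moreover have "R = (if 2 * bits_nat bs \<le> r then [True] else unary_pair n y)"
        using Suc True v by (auto simp: R_def bs2_def)
      ultimately show ?thesis
        by (auto elim!: yields_mono)
    qed
  qed
qed

section \<open>Reading and copying the input\<close>

definition marks :: "nat \<Rightarrow> int \<Rightarrow> symbol" where
  "marks j = (\<lambda>i. if 0 \<le> i \<and> i < int j then Bit True else Blank)"

lemma undo_move_marks: "undo_move (marks j i) = None"
  by (simp add: marks_def undo_move_def)

text \<open>Of the ones after the first two, \<open>j\<close> have been counted and \<open>d\<close>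
  are left. The separator in cell \<open>n\<close> ends the loop and sends the auxiliary head to
  cell \<open>n - 3\<close>, where the last mark stands if there is any.\<close>

lemma dist_count_ones:
  assumes n: "n \<ge> 2" and "2 + j + d = n"
    and "yields (dist_fn M) t (3, (int n + 1, marked_input n y) # (int (n - 2) - 1, marks (n - 2)) # X # ts) P"
  shows "yields (dist_fn M) (t + d + 1) (2, (2 + int j, marked_input n y) # (int j, marks j) # X # ts) P"
  using assms(2)
proof (induction d arbitrary: j)
  case 0
  then have "n - 2 = j" "2 + int j = int n" by auto
  then show ?case
    using marked_input_simps(4)[OF n, of y] assms(3) 
    by - (simp, rule yields_det, auto simp: algebra_simps fun_upd_idem)
next
  case (Suc d)
  have "(marks j)(int j := Bit True) = marks (Suc j)"
    by (auto simp: marks_def)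
  moreover have "marked_input n y (2 + int j) = Bit True"
    using Suc.prems by (intro marked_input_simps(3)[OF n]) auto
  moreover have "yields (dist_fn M) (t + d + 1)
      (2, (2 + int (Suc j), marked_input n y) # (int (Suc j), marks (Suc j)) # X # ts) P"
    using Suc.prems by (intro Suc.IH) simp
  ultimately have "yields (dist_fn M) (Suc (t + d + 1))
      (2, (2 + int j, marked_input n y) # (int j, marks j) # X # ts) P"
    by - (rule yields_det, auto simp: algebra_simps fun_upd_idem)
  then show ?case by simp
qed

text \<open>Here \<open>j\<close> bits have been copied and the marks still pay for \<open>b\<close>
  more. An odd \<open>b\<close> means that the mark under the head has paid for one of its two bits,
  which is state 4.\<close>

definition copy_config ::
    "nat \<Rightarrow> bool list \<Rightarrow> tape list \<Rightarrow> nat \<Rightarrow> nat \<Rightarrow> config" where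
  "copy_config n y ts b j =
     (if even b then 3 else 4, (int n + 1 + int j, marked_input n y) #
        (int ((b + 1) div 2) - 1, marks (n - 2)) # (int j, input_tape (take j y)) # ts)"

lemma input_tape_snoc:
  assumes "j < length y"
  shows "(input_tape (take j y))(int j := Bit (y ! j)) = input_tape (take (Suc j) y)"
  using assms by (auto simp: input_tape_def fun_eq_iff less_Suc_eq)

lemma dist_copy_step:
  assumes "n \<ge> 2" "b < 2 * (n - 2)" "j < length y"
    and "yields (dist_fn M) t (copy_config n y ts b (Suc j)) P"
  shows "yields (dist_fn M) (Suc t) (copy_config n y ts (Suc b) j) P"
proof -
  note I = marked_input_simps(5)[OF assms(1,3)]
  show ?thesis
  proof (cases "even b")
    case True
    then have "int ((Suc b + 1) div 2) - 1 = int (b div 2)" "int ((b + 1) div 2) - 1 = int (b div 2) - 1"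
      by auto
    then show ?thesis
      using assms(4) True I unfolding copy_config_def
      by - (rule yields_det, auto simp: input_tape_snoc[OF assms(3)] algebra_simps fun_upd_idem)
  next
    case False
    then obtain c where "b = 2 * c + 1" by (auto elim: oddE)
    then have "int ((Suc b + 1) div 2) - 1 = int c" "int ((b + 1) div 2) - 1 = int c"
      "marks (n - 2) (int c) = Bit True"
      using assms(2) by (auto simp: marks_def)
    then show ?thesis
      using assms(4) False I unfolding copy_config_def
      by - (rule yields_det, auto simp: input_tape_snoc[OF assms(3)] algebra_simps fun_upd_idem)
  qed
qed

text \<open>Once \<open>b\<close> is exhausted, the auxiliary head stands on the blank in cell -1
  while a bit of \<open>y\<close> is still to be read, so the machine halts. The purpose is the time
  bound, since the distinguisher must stop on every \<open>y\<close>.\<close>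

lemma dist_copy_too_long:
  assumes "n \<ge> 2" "b \<le> 2 * (n - 2)" "j + b < length y"
  shows "\<exists>P. yields (dist_fn M) b (copy_config n y ts b j) P"
  using assms(2,3)
proof (induction b arbitrary: j)
  case 0
  have "\<not> is_Bit (marks (n - 2) (- 1))"
    by (simp add: marks_def)
  moreover have "is_Bit (marked_input n y (int n + 1 + int j))"
    using marked_input_simps(5)[OF assms(1), of j y] 0 by simp
  ultimately have "fn_halted (dist_fn M) (copy_config n y ts 0 j)"
    by (simp add: fn_halted_def copy_config_def)
  then show ?case using yields_halted by blast
next
  case (Suc b)
  have "\<exists>P. yields (dist_fn M) b (copy_config n y ts b (Suc j)) P"
    using Suc.prems by (intro Suc.IH) auto
  then obtain P where "yields (dist_fn M) b (copy_config n y ts b (Suc j)) P" ..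
  then show ?case
    using dist_copy_step[OF assms(1), of b j y M b ts P] Suc.prems by auto
qed

text \<open>The final position of the auxiliary head depends on how many marks are left, so the rest
  of the computation is assumed for every \<open>p\<close>.\<close>

lemma dist_copy_input:
  assumes n: "n \<ge> 2" and "b \<le> 2 * (n - 2)" "j + d = length y" "d \<le> b"
    and "\<And>p. yields (dist_fn M) t (5, (int (n + length y), marked_input n y) #
      (p, marks (n - 2)) # (int (length y) - 1, input_tape y) # ts) P"
  shows "yields (dist_fn M) (t + d + 1) (copy_config n y ts b j) P"
  using assms(2-4)
proof (induction d arbitrary: b j)
  case 0
  then have "j = length y" by simp
  then have "yields (dist_fn M) (Suc t) (copy_config n y ts b j) P"
    using marked_input_simps(6)[OF n, of y] assms(5)[of "int ((b + 1) div 2) - 1"]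
    unfolding copy_config_def
    by (cases "even b"; simp del: dist_fn.simps)
      (rule yields_det, auto simp: algebra_simps fun_upd_idem)+
  then show ?case by simp
next
  case (Suc d)
  then obtain b' where b: "b = Suc b'" by (cases b) auto
  have "yields (dist_fn M) (t + d + 1) (copy_config n y ts b' (Suc j)) P"
    using Suc.prems b by (intro Suc.IH) auto
  then show ?case
    using dist_copy_step[OF n, of b' j y M "t + d + 1" ts P] Suc.prems b by auto
qed

section \<open>Rewinding and simulation\<close>

lemma dist_rewind:
  assumes "j \<le> length y"
    and "yields (dist_fn M) t (10, I # A # (0, input_tape y) # ts) P"
  shows "yields (dist_fn M) (t + j + 1) (5, I # A # (int j - 1, input_tape y) # ts) P"
  using assms(1)
proof (induction j)
  case 0
  have "input_tape y (- 1) = Blank" by (simp add: input_tape_def)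
  then show ?case
    using assms(2) by - (simp, rule yields_det, auto simp: fun_upd_idem)
next
  case (Suc j)
  then have "is_Bit (input_tape y (int j))"
    by (simp add: input_tape_def)
  moreover have "yields (dist_fn M) (t + j + 1) (5, I # A # (int j - 1, input_tape y) # ts) P"
    using Suc by simp
  ultimately have "yields (dist_fn M) (Suc (t + j + 1)) (5, I # A # (int j, input_tape y) # ts) P"
    by - (rule yields_det, auto)
  then show ?case by simp
qed

text \<open>The invariant is that the head on the first tape of \<open>M\<close> stands at the sum
  of the \<open>r\<close> recorded moves. The premise \<open>fin\<close> describes everything after
  \<open>M\<close> has halted, for an arbitrary record and tape. As \<open>h + t\<close> is at most
  \<open>B\<close>, the cells from \<open>B\<close> on stay blank, which later bounds the length of
  the output.\<close>

lemma dist_simulate: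
  assumes M: "ptm_tapes k M"
    and fin: "\<And>a r h x ts. undo_move (a (p - 1)) = None \<Longrightarrow>
        (\<And>i. i < r \<Longrightarrow> undo_move (a (p + int i)) \<noteq> None) \<Longrightarrow>
        h = (\<Sum>i<r. displacement (a (p + int i))) \<Longrightarrow> r \<le> R \<Longrightarrow> (\<And>i. i \<ge> int B \<Longrightarrow> x i = Blank) \<Longrightarrow>
        yields (dist_fn M) s (6, I # (p + int r - 1, a) # (h, x) # ts) (return_pmf (f (tape_bits (h, x))))"
    and "undo_move (a (p - 1)) = None" "\<And>i. i < r \<Longrightarrow> undo_move (a (p + int i)) \<noteq> None"
    and "h = (\<Sum>i<r. displacement (a (p + int i)))" "r + t \<le> R"
    and "\<And>i. i \<ge> int B \<Longrightarrow> x i = Blank" "h + int t \<le> int B" "length ts = k - 1"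
    and "\<And>c. c \<in> set_pmf (ptm_run M t (q, (h, x) # ts)) \<Longrightarrow> entry M c = None"
  shows "yields (dist_fn M) (s + t + 1) (10 + q, I # (p + int r, a) # (h, x) # ts)
    (map_pmf (f \<circ> tm_output) (ptm_run M t (q, (h, x) # ts)))"
  using assms(3-)
proof (induction t arbitrary: q h x ts a r)
  case (0 q h x ts a r)
  have "entry M (q, (h, x) # ts) = None"
    using "0.prems"(8) by simp
  moreover have "yields (dist_fn M) s (6, I # (p + int r - 1, a) # (h, x) # ts)
      (return_pmf (f (tape_bits (h, x))))"
    using "0.prems" by (intro fin) auto
  ultimately have "yields (dist_fn M) (Suc s) (10 + q, I # (p + int r, a) # (h, x) # ts)
      (return_pmf (f (tape_bits (h, x))))"
    by - (rule yields_det, auto)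
  then show ?case
    by (simp add: tm_output_def)
next
  case (Suc t q h x ts a r)
  show ?case
  proof (cases "entry M (q, (h, x) # ts)")
    case None
    \<comment> \<open>\<open>M\<close> has halted before its time is up; further steps leave its run
      unchanged, so the induction hypothesis applies to the same configuration.\<close>
    then have run: "ptm_run M t' (q, (h, x) # ts) = return_pmf (q, (h, x) # ts)" for t'
      by (simp add: ptm_run_eq_fn_run fn_run_halted fn_halted_def)
    have "yields (dist_fn M) (s + t + 1) (10 + q, I # (p + int r, a) # (h, x) # ts)
        (map_pmf (f \<circ> tm_output) (ptm_run M t (q, (h, x) # ts)))"
      using Suc.prems(4,6) None
      by (intro Suc.IH[OF Suc.prems(1-3) _ Suc.prems(5) _ Suc.prems(7)]) (auto simp: run)
    then show ?thesis
      unfolding run by (rule yields_mono) simp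
  next
    case (Some ab)
    obtain u v where ab: "ab = (u, v)" by (cases ab)
    have "((q, x h # map tape_read ts), (u, v)) \<in> set M"
      using Some ab by (auto dest: map_of_SomeD)
    then have len: "length (snd u) = k" "length (snd v) = k" and "k \<ge> 1"
      using M by (auto simp: ptm_tapes_def split_beta)
    have step: "yields (dist_fn M) (s + t + 1)
        (perform (sim_act (tape_read I) w) (10 + q, I # (p + int r, a) # (h, x) # ts))
        (map_pmf (f \<circ> tm_output) (ptm_run M t (perform w (q, (h, x) # ts))))"
      if w: "w = u \<or> w = v" for w
    proof -
      have "length (snd w) = k" using len w by auto
      then obtain s' m as where as: "snd w = (s', m) # as"
        using \<open>k \<ge> 1\<close> by (cases "snd w") auto
      define a' where "a' = a(p + int r := move_code m)"
      have 1: "perform w (q, (h, x) # ts) = (fst w, (move_head m h, x(h := s')) # map2 tape_act as ts)"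
        by (simp add: perform_conv as)
      have 2: "perform (sim_act (tape_read I) w) (10 + q, I # (p + int r, a) # (h, x) # ts) =
          (10 + fst w, I # (p + int (Suc r), a') # (move_head m h, x(h := s')) # map2 tape_act as ts)"
        by (simp add: perform_conv as sim_act_def a'_def)
      show ?thesis
        unfolding 1 2
      proof (rule Suc.IH)
        show "undo_move (a' (p - 1)) = None"
          using Suc.prems(1) by (simp add: a'_def)
        show "undo_move (a' (p + int i)) \<noteq> None" if "i < Suc r" for i
          using that Suc.prems(2)[of i] undo_move_code[of m] by (auto simp: a'_def less_Suc_eq)
        show "move_head m h = (\<Sum>i<Suc r. displacement (a' (p + int i)))"
          using Suc.prems(3) by (simp add: a'_def move_head_code)
        show "Suc r + t \<le> R"
          using Suc.prems(4) by simp
        show "(x(h := s')) i = Blank" if "i \<ge> int B" for i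
          using Suc.prems(5)[OF that] Suc.prems(6) that by auto
        show "move_head m h + int t \<le> int B"
          using Suc.prems(6) by (cases m) auto
        show "length (map2 tape_act as ts) = k - 1"
          using Suc.prems(7) as \<open>length (snd w) = k\<close> by auto
        show "entry M c = None"
          if "c \<in> set_pmf (ptm_run M t (fst w, (move_head m h, x(h := s')) # map2 tape_act as ts))" for c
        proof -
          \<comment> \<open>The successor lies in the support of the first step, so it inherits
            halting on all branches.\<close>
          have "perform w (q, (h, x) # ts) \<in> set_pmf (ptm_step M (q, (h, x) # ts))"
            using w unfolding ptm_step_def Some ab
            by (auto simp del: entry.simps perform.simps
                intro: image_eqI[of _ _ True] image_eqI[of _ _ False])
          then show ?thesis
            using Suc.prems(8)[of c] that by (auto simp only: 1 ptm_run.simps set_bind_pmf)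
        qed
      qed
    qed
    have run: "map_pmf (f \<circ> tm_output) (ptm_run M (Suc t) (q, (h, x) # ts)) =
        bind_pmf (bernoulli_pmf (1 / 2)) (\<lambda>coin. map_pmf (f \<circ> tm_output)
          (ptm_run M t (perform (if coin then u else v) (q, (h, x) # ts))))"
      by (simp add: ptm_step_def Some ab map_bind_pmf bind_map_pmf del: entry.simps perform.simps)
    have "yields (dist_fn M) (Suc (s + t + 1)) (10 + q, I # (p + int r, a) # (h, x) # ts)
        (map_pmf (f \<circ> tm_output) (ptm_run M (Suc t) (q, (h, x) # ts)))"
      unfolding run
    proof (rule yields_coin)
      show "dist_fn M (fst (10 + q, I # (p + int r, a) # (h, x) # ts))
          (map tape_read (snd (10 + q, I # (p + int r, a) # (h, x) # ts))) =
          Some (sim_act (tape_read I) u, sim_act (tape_read I) v)"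
        using Some ab by simp
      show "yields (dist_fn M) (s + t + 1)
          (perform (if coin then sim_act (tape_read I) u else sim_act (tape_read I) v)
            (10 + q, I # (p + int r, a) # (h, x) # ts))
          (map_pmf (f \<circ> tm_output) (ptm_run M t (perform (if coin then u else v) (q, (h, x) # ts))))" for coin
        using step[of u] step[of v] by (cases coin) auto
    qed
    then show ?thesis by (rule yields_mono) simp
  qed
qed

lemma dist_start:
  assumes "n \<ge> 2" "yields (dist_fn M) t (2, (2, marked_input n y) # A # X # ts) P"
  shows "yields (dist_fn M) (Suc (Suc t)) (0, (0, input_tape (unary_pair n y)) # A # X # ts) P"
proof -
  have "input_tape (unary_pair n y) 0 = Bit True" "input_tape (unary_pair n y) 1 = Bit True"
    using assms(1) by (auto simp: input_tape_def unary_pair_def nth_append)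
  moreover have "yields (dist_fn M) t
      (2, (2, (input_tape (unary_pair n y))(1 := Blank)) # A # X # ts) P"
    using assms(2) by (simp add: marked_input_def)
  ultimately show ?thesis
    by - (rule yields_det, simp, simp add: fun_upd_idem, rule yields_det, auto)
qed

lemma marks_0: "marks 0 = (\<lambda>_. Blank)"
  by (auto simp: marks_def)

text \<open>The phases are joined from the last to the first. The output of \<open>M\<close> has at
  most \<open>length y + T\<close> bits, which bounds each round of the comparison; about
  \<open>T\<close> steps each go to simulating and unwinding, \<open>length y\<close> each to
  copying and rewinding, and \<open>n\<close> to counting.\<close>

lemma dist_fn_yields:
  assumes M: "ptm_tapes k M" and n: "n \<ge> 2" and y: "length y \<le> 2 * (n - 2)"
    and halt: "\<And>c. c \<in> set_pmf (ptm_run M T (init k y)) \<Longrightarrow> entry M c = None"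
  shows "yields (dist_fn M)
    ((n + length y) * (2 * (length y + T) + 6) + 2 * T + 2 * length y + n + 10)
    (init (k + 2) (unary_pair n y))
    (map_pmf ((\<lambda>h. if 2 * bits_nat h \<le> n + length y - 1 then [True] else unary_pair n y) \<circ> tm_output)
      (ptm_run M T (init k y)))"
proof -
  define m where "m = length y"
  define f where "f h = (if 2 * bits_nat h \<le> n + length y - 1 then [True] else unary_pair n y)" for h
  define P where "P = map_pmf (f \<circ> tm_output) (ptm_run M T (init k y))"
  define I where "I = (int (n + m), marked_input n y)"
  define cmp where "cmp = (n + m) * (2 * (m + T) + 6)"
  obtain k' where k: "k = Suc k'"
    using M by (cases k) (auto simp: ptm_tapes_def)
  define ts :: "tape list" where "ts = replicate k' (0, \<lambda>_. Blank)"
  have init: "init k y = (0, (0, input_tape y) # ts)"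
    "init (k + 2) (unary_pair n y) =
      (0, (0, input_tape (unary_pair n y)) # (0, \<lambda>_. Blank) # (0, \<lambda>_. Blank) # ts)"
    by (simp_all add: k ts_def init_conv)
  have fin: "yields (dist_fn M) (cmp + T + 1) (6, I # (p + int r - 1, a) # (h, x) # ts')
      (return_pmf (f (tape_bits (h, x))))"
    if "undo_move (a (p - 1)) = None" "\<And>i. i < r \<Longrightarrow> undo_move (a (p + int i)) \<noteq> None"
      "h = (\<Sum>i<r. displacement (a (p + int i)))" "r \<le> T" "\<And>i. i \<ge> int (m + T) \<Longrightarrow> x i = Blank"
    for p a r h x ts'
  proof -
    define bs where "bs = tape_bits (h, x)"
    have "\<not> is_Bit (x (int (m + T)))"
      using that(5)[of "int (m + T)"] by simp
    then have bs: "holds_bits x bs" "length bs \<le> m + T"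
      unfolding bs_def by (rule holds_bits_tape_bits)+
    \<comment> \<open>Copying leaves the input head on the last input cell \<open>n + m\<close>, so
      the countdown starts with \<open>r = n + m - 1\<close>.\<close>
    have "yields (dist_fn M) ((n + m - 1 + 1) * (2 * length bs + 6))
        (7, (int (n + m - 1) + 1, marked_input n y) # (p, a) # (0, x) # ts')
        (return_pmf (if 2 * bits_nat bs \<le> n + m - 1 then [True] else unary_pair n y))"
      using that(1) bs(1) by (intro dist_compare[OF n]) (auto simp: m_def)
    then have "yields (dist_fn M) ((n + m - 1 + 1) * (2 * length bs + 6)) (7, I # (p, a) # (0, x) # ts')
        (return_pmf (f bs))"
      using n by (simp add: I_def f_def m_def)
    moreover have "(n + m - 1 + 1) * (2 * length bs + 6) \<le> cmp"
      unfolding cmp_def using bs(2) n by (intro mult_mono) auto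
    ultimately have "yields (dist_fn M) cmp (7, I # (p, a) # (0, x) # ts') (return_pmf (f bs))"
      by (rule yields_mono)
    then have "yields (dist_fn M) (cmp + r + 1) (6, I # (p + int r - 1, a) # (h, x) # ts')
        (return_pmf (f bs))"
      unfolding that(3) using that(1,2) by (intro dist_unwind)
    then show ?thesis
      unfolding bs_def by (rule yields_mono) (use that(4) in simp)
  qed
  have sim: "yields (dist_fn M) (cmp + T + 1 + T + 1) (10, I # (p, marks (n - 2)) # (0, input_tape y) # ts) P" for p
  proof -
    have "yields (dist_fn M) (cmp + T + 1 + T + 1) (10 + 0, I # (p + int 0, marks (n - 2)) # (0, input_tape y) # ts)
        (map_pmf (f \<circ> tm_output) (ptm_run M T (0, (0, input_tape y) # ts)))"
    proof (rule dist_simulate[OF M, where B = "m + T" and R = T and p = p])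
      show "entry M c = None" if "c \<in> set_pmf (ptm_run M T (0, (0, input_tape y) # ts))" for c
        using halt that unfolding init .
      show "yields (dist_fn M) (cmp + T + 1) (6, I # (p + int r - 1, a) # (h, x) # ts')
          (return_pmf (f (tape_bits (h, x))))"
        if "undo_move (a (p - 1)) = None" "\<And>i. i < r \<Longrightarrow> undo_move (a (p + int i)) \<noteq> None"
          "h = (\<Sum>i<r. displacement (a (p + int i)))" "r \<le> T" "\<And>i. i \<ge> int (m + T) \<Longrightarrow> x i = Blank"
        for a r h x ts'
        using that by (rule fin)
    \<comment> \<open>Cell \<open>p - 1\<close> holds a mark or a blank; neither encodes a move, so
      it bounds the record from below.\<close>
    qed (auto intro!: undo_move_marks simp: ts_def k m_def input_tape_def)
    then show ?thesis
      by (simp add: P_def init)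
  qed
  have rewind: "yields (dist_fn M) (cmp + T + 1 + T + 1 + m + 1)
      (5, (int (n + m), marked_input n y) # (p, marks (n - 2)) # (int m - 1, input_tape y) # ts) P" for p
    using sim[of p] unfolding m_def I_def by (intro dist_rewind) simp_all
  have "yields (dist_fn M) (cmp + T + 1 + T + 1 + m + 1 + m + 1) (copy_config n y ts (2 * (n - 2)) 0) P"
    using y rewind by (intro dist_copy_input[OF n]) (simp_all add: m_def)
  moreover have "copy_config n y ts (2 * (n - 2)) 0 =
      (3, (int n + 1, marked_input n y) # (int (n - 2) - 1, marks (n - 2)) # (0, \<lambda>_. Blank) # ts)"
    by (simp add: copy_config_def input_tape_def)
  ultimately have "yields (dist_fn M) (cmp + T + 1 + T + 1 + m + 1 + m + 1 + (n - 2) + 1)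
      (2, (2 + int 0, marked_input n y) # (int 0, marks 0) # (0, \<lambda>_. Blank) # ts) P"
    using n by (intro dist_count_ones[OF n]) simp_all
  then have "yields (dist_fn M) (Suc (Suc (cmp + T + 1 + T + 1 + m + 1 + m + 1 + (n - 2) + 1)))
      (init (k + 2) (unary_pair n y)) P"
    unfolding init by (intro dist_start[OF n]) (simp add: marks_0)
  then show ?thesis
    unfolding P_def f_def cmp_def by (rule yields_mono) (use n in \<open>simp add: m_def\<close>)
qed

text \<open>Either the separator comes too early or the marks run out. What counts here is a time
  bound in \<open>n\<close> alone.\<close>

lemma dist_fn_halts:
  assumes M: "ptm_tapes k M" and halt: "\<not> (n \<ge> 2 \<and> length y \<le> 2 * (n - 2))"
  shows "\<exists>P. yields (dist_fn M) (3 * n + 10) (init (k + 2) (unary_pair n y)) P"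
proof -
  obtain k' where k: "k = Suc k'"
    using M by (cases k) (auto simp: ptm_tapes_def)
  define ts :: "tape list" where "ts = replicate k' (0, \<lambda>_. Blank)"
  have init: "init (k + 2) (unary_pair n y) =
      (0, (0, input_tape (unary_pair n y)) # (0, \<lambda>_. Blank) # (0, \<lambda>_. Blank) # ts)"
    by (simp add: k ts_def init_conv)
  consider "n = 0" | "n = 1" | "n \<ge> 2" "2 * (n - 2) < length y"
    using halt by linarith
  then show ?thesis
  proof cases
    case 1
    then have "fn_halted (dist_fn M) (init (k + 2) (unary_pair n y))"
      unfolding init by (simp add: fn_halted_def input_tape_def unary_pair_def)
    then show ?thesis using yields_halted by blast
  next
    case 2
    define c :: config where
      "c = (1, (1, input_tape (unary_pair n y)) # (0, \<lambda>_. Blank) # (0, \<lambda>_. Blank) # ts)"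
    have "fn_halted (dist_fn M) c"
      using 2 by (simp add: c_def fn_halted_def input_tape_def unary_pair_def)
    then have "yields (dist_fn M) 0 c (return_pmf (tm_output c))"
      using yields_halted by blast
    moreover have "input_tape (unary_pair n y) 0 = Bit True"
      using 2 by (simp add: input_tape_def unary_pair_def)
    ultimately have "yields (dist_fn M) (Suc 0) (init (k + 2) (unary_pair n y)) (return_pmf (tm_output c))"
      unfolding init c_def by - (rule yields_det, auto simp: fun_upd_idem)
    then have "yields (dist_fn M) (3 * n + 10) (init (k + 2) (unary_pair n y)) (return_pmf (tm_output c))"
      by (rule yields_mono) simp
    then show ?thesis ..
  next
    case 3
    then obtain P where "yields (dist_fn M) (2 * (n - 2)) (copy_config n y ts (2 * (n - 2)) 0) P"
      using dist_copy_too_long[OF 3(1), of "2 * (n - 2)" 0 y M ts] by auto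
    moreover have "copy_config n y ts (2 * (n - 2)) 0 =
        (3, (int n + 1, marked_input n y) # (int (n - 2) - 1, marks (n - 2)) # (0, \<lambda>_. Blank) # ts)"
      by (simp add: copy_config_def input_tape_def)
    ultimately have "yields (dist_fn M) (2 * (n - 2) + (n - 2) + 1)
        (2, (2 + int 0, marked_input n y) # (int 0, marks 0) # (0, \<lambda>_. Blank) # ts) P"
      using 3(1) by (intro dist_count_ones[OF 3(1)]) simp_all
    then have "yields (dist_fn M) (Suc (Suc (2 * (n - 2) + (n - 2) + 1)))
        (init (k + 2) (unary_pair n y)) P"
      unfolding init by (intro dist_start[OF 3(1)]) (simp add: marks_0)
    then have "yields (dist_fn M) (3 * n + 10) (init (k + 2) (unary_pair n y)) P"
      by (rule yields_mono) (use 3(1) in simp)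
    then show ?thesis ..
  qed
qed

section \<open>From the transition function to a polynomial-time machine\<close>

lemma ptm_bounded:
  fixes M :: ptm
  obtains W where "\<And>key a b. (key, a, b) \<in> set M \<Longrightarrow>
     fst a < W \<and> fst b < W \<and> (\<forall>i. Work i \<in> fst ` set (snd a) \<union> fst ` set (snd b) \<longrightarrow> i < W)"
proof -
  define Z where "Z = (\<Union>e \<in> set M. fst ` set (snd (fst (snd e))) \<union> fst ` set (snd (snd (snd e))))"
  define F where "F = (\<lambda>e. fst (fst (snd e))) ` set M \<union> (\<lambda>e. fst (snd (snd e))) ` set M \<union> Work -` Z"
  have "finite F"
    unfolding F_def Z_def by (auto intro!: finite_vimageI injI)
  then obtain W where W: "\<And>i. i \<in> F \<Longrightarrow> i < W"
    unfolding finite_nat_set_iff_bounded by blast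
  show thesis
  proof (rule that[of W])
    fix key a b assume e: "(key, a, b) \<in> set M"
    show "fst a < W \<and> fst b < W \<and> (\<forall>i. Work i \<in> fst ` set (snd a) \<union> fst ` set (snd b) \<longrightarrow> i < W)"
    proof (intro conjI allI impI)
      show "fst a < W"
        by (rule W, unfold F_def, rule UnI1, rule UnI1, rule rev_image_eqI[OF e]) simp
      show "fst b < W"
        by (rule W, unfold F_def, rule UnI1, rule UnI2, rule rev_image_eqI[OF e]) simp
      show "i < W" if "Work i \<in> fst ` set (snd a) \<union> fst ` set (snd b)" for i
        using e that by (intro W) (force simp: F_def Z_def)
    qed
  qed
qed

lemma closed_dist_fn:
  assumes M: "ptm_tapes k M"
  obtains S Q where "closed_fn (k + 2) S Q (dist_fn M)" "{Blank, Bit False, Bit True} \<subseteq> set S" "0 < Q"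
proof -
  obtain W0 where W0: "\<And>key a b. (key, a, b) \<in> set M \<Longrightarrow>
     fst a < W0 \<and> fst b < W0 \<and> (\<forall>i. Work i \<in> fst ` set (snd a) \<union> fst ` set (snd b) \<longrightarrow> i < W0)"
    using ptm_bounded by blast
  \<comment> \<open>The surplus of 3 covers the move codes \<open>Work 0\<close> to
    \<open>Work 2\<close>. As the states of \<open>M\<close> are shifted by 10, the state bound is
    \<open>10 + W\<close>.\<close>
  define W where "W = W0 + 3"
  define S where "S = Blank # Bit False # Bit True # map Work [0..<W]"
  have S: "s \<in> set S \<longleftrightarrow> (\<forall>i. s = Work i \<longrightarrow> i < W)" for s
    by (cases s) (auto simp: S_def)
  have det: "act_fits (k + 2) S (10 + W) u \<and> act_fits (k + 2) S (10 + W) v"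
    if "det_act q i a x ss = Some (u, v)" "q \<le> 10" "{fst i, fst a, fst x} \<union> set ss \<subseteq> set S"
      "length ss + 3 = k + 2" for q i a x ss u v
    using that by (auto simp: det_act_def act_fits_def W_def Let_def)
  have sim: "act_fits (k + 2) S (10 + W) (sim_act i u) \<and> act_fits (k + 2) S (10 + W) (sim_act i v)"
    if "map_of M key = Some (u, v)" "i \<in> set S" for i u v key
  proof -
    have e: "(key, u, v) \<in> set M" using that(1) by (rule map_of_SomeD)
    then have "length (snd u) = k" "length (snd v) = k"
      using M by (auto simp: ptm_tapes_def split_beta)
    moreover have "fst ` set (snd u) \<subseteq> set S" "fst ` set (snd v) \<subseteq> set S" "fst u < W" "fst v < W"
      using W0[OF e] by (auto simp: S W_def simp del: Un_iff) (force)+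
    moreover have "move_code m \<in> set S" for m
      by (cases m) (auto simp: S W_def)
    ultimately show ?thesis
      using that(2) by (auto simp: act_fits_def sim_act_def)
  qed
  have "closed_fn (k + 2) S (10 + W) (dist_fn M)"
    unfolding closed_fn_def
  proof (intro allI impI)
    fix q ss u v
    assume q: "q < 10 + W" "set ss \<subseteq> set S" "length ss = k + 2" and d: "dist_fn M q ss = Some (u, v)"
    obtain i a x ss' where ss: "ss = i # a # x # ss'"
      using d by (cases "(M, q, ss)" rule: dist_fn.cases) auto
    have *: "{i, a, x} \<union> set ss' \<subseteq> set S" "length ss' + 3 = k + 2"
      using q ss by auto
    have **: "Blank \<in> set S" "Bit b \<in> set S" "Work 2 \<in> set S" for b
      by (auto simp: S W_def)
    show "act_fits (k + 2) S (10 + W) u \<and> act_fits (k + 2) S (10 + W) v"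
      using d * ** unfolding ss dist_fn.simps
      by (auto split: if_splits option.splits prod.splits dest!: det dest: sim)
  qed
  then show thesis
    by (rule that) (auto simp: S_def)
qed

lemma poly_nat_mono:
  fixes p :: "nat poly"
  shows "a \<le> b \<Longrightarrow> poly p a \<le> poly p b"
  by (induction p) (auto intro!: add_mono mult_mono)

text \<open>The range of \<open>y\<close> suits generator outputs, which exceed the seed by a
  logarithmic length only. For \<open>n \<ge> 2\<close> the rejecting output
  \<open>unary_pair n y\<close> differs from \<open>[True]\<close> by its length.\<close>

lemma threshold_distinguisher:
  assumes "ppt H"
  obtains D where "ppt_distinguisher D"
    "\<And>n y. n \<ge> 2 \<Longrightarrow> length y \<le> 2 * (n - 2) \<Longrightarrow>
       D n y = map_pmf (\<lambda>h. if 2 * bits_nat h \<le> n + length y - 1 then [True] else unary_pair n y) (H y)"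
proof -
  obtain k M and p :: "nat poly" where M: "ptm_tapes k M"
    and H: "\<And>x. ptm_result_within k M x (poly p (length x)) (H x)"
    using assms unfolding ppt_def by blast
  obtain S Q where SQ: "closed_fn (k + 2) S Q (dist_fn M)" "{Blank, Bit False, Bit True} \<subseteq> set S" "0 < Q"
    using closed_dist_fn[OF M] by blast
  \<comment> \<open>As \<open>length y \<le> 2 * n\<close>, the time of the heuristic on
    \<open>y\<close> is at most the value of \<open>p\<close> at \<open>2 * n\<close>, a polynomial
    in \<open>n\<close> alone.\<close>
  define p' where "p' = pcompose p [:0, 2:]"
  have p': "poly p' n = poly p (2 * n)" for n
    by (simp add: p'_def poly_pcompose mult.commute)
  define q :: "nat poly" where
    "q = [:0, 3:] * (2 * ([:0, 2:] + p') + 6) + 2 * p' + [:10, 5:]"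
  have q: "poly q n = 3 * n * (2 * (2 * n + poly p (2 * n)) + 6) + 2 * poly p (2 * n) + 5 * n + 10" for n
    by (simp add: q_def p' algebra_simps)
  define good where "good n y \<longleftrightarrow> n \<ge> 2 \<and> length y \<le> 2 * (n - 2)" for n and y :: "bool list"
  define g where "g n y h = (if 2 * bits_nat h \<le> n + length y - 1 then [True] else unary_pair n y)" for n y h
  have "\<exists>P. yields (dist_fn M) (poly q n) (init (k + 2) (unary_pair n y)) P \<and>
      (good n y \<longrightarrow> P = map_pmf (g n y) (H y))" for n y
  proof (cases "good n y")
    case True
    define T where "T = poly p (length y)"
    have len: "length y \<le> 2 * n" using True by (auto simp: good_def)
    then have T: "T \<le> poly p (2 * n)" unfolding T_def by (rule poly_nat_mono)
    have "yields (dist_fn M)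
        ((n + length y) * (2 * (length y + T) + 6) + 2 * T + 2 * length y + n + 10)
        (init (k + 2) (unary_pair n y))
        (map_pmf (g n y \<circ> tm_output) (ptm_run M T (init k y)))"
      using True H[of y] unfolding g_def good_def ptm_result_within_def T_def
      by (intro dist_fn_yields[OF M]) auto
    moreover have "(n + length y) * (2 * (length y + T) + 6) \<le> 3 * n * (2 * (2 * n + poly p (2 * n)) + 6)"
      using len T by (intro mult_mono) auto
    then have "(n + length y) * (2 * (length y + T) + 6) + 2 * T + 2 * length y + n + 10 \<le> poly q n"
      unfolding q using len T by linarith
    ultimately have "yields (dist_fn M) (poly q n) (init (k + 2) (unary_pair n y))
        (map_pmf (g n y \<circ> tm_output) (ptm_run M T (init k y)))"
      by (rule yields_mono)
    moreover have "map_pmf (g n y \<circ> tm_output) (ptm_run M T (init k y)) = map_pmf (g n y) (H y)"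
      using H[of y] by (simp add: ptm_result_within_def T_def pmf.map_comp)
    ultimately show ?thesis by auto
  next
    case False
    then obtain P where "yields (dist_fn M) (3 * n + 10) (init (k + 2) (unary_pair n y)) P"
      using dist_fn_halts[OF M] unfolding good_def by blast
    then have "yields (dist_fn M) (poly q n) (init (k + 2) (unary_pair n y)) P"
      by (rule yields_mono) (simp add: q)
    then show ?thesis using False by blast
  qed
  then obtain D where D: "\<And>n y. yields (dist_fn M) (poly q n) (init (k + 2) (unary_pair n y)) (D n y)"
    "\<And>n y. good n y \<Longrightarrow> D n y = map_pmf (g n y) (H y)"
    by metis
  have "fits (k + 2) S Q (init (k + 2) (unary_pair n y))" for n y
  proof -
    have "Bit b \<in> set S" "Blank \<in> set S" for b
      using SQ(2) by (cases b; simp)+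
    then show ?thesis
      using SQ(3) by (auto simp: fits_def init_def)
  qed
  then have "ppt_distinguisher D"
    unfolding ppt_distinguisher_def using fn_table_tapes[OF SQ(1)] fn_table_result[OF SQ(1) _ D(1)]
    by (intro exI[of _ "k + 2"] exI[of _ "fn_table (k + 2) S Q (dist_fn M)"] exI[of _ q]) auto
  then show thesis
    using that D(2) unfolding good_def g_def by blast
qed

section \<open>Output lengths of the generators\<close>

text \<open>Let \<open>n + 1\<close> be the least seed length whose output length exceeds
  \<open>m\<close>. The skipped \<open>m\<close> lies strictly between the output lengths for
  \<open>n\<close> and \<open>n + 1\<close>, so \<open>\<gamma> log\<close> reaches or passes the
  integer \<open>j = m - n\<close> there.\<close>

lemma ext_length_skipped:
  assumes "\<gamma> > 0" "m \<ge> 1" "\<And>n. ext_length \<gamma> n \<noteq> m"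
  obtains n j :: nat where "n \<ge> 1" "j \<ge> 1" "m = n + j" "\<gamma> * log 2 (real n) < real j" "real j \<le> \<gamma> * log 2 (real n + 1)"
proof -
  define n0 where "n0 = (LEAST n. ext_length \<gamma> n > m)"
  have "ext_length \<gamma> (Suc m) > m"
    by (simp add: ext_length_def)
  then have n0: "ext_length \<gamma> n0 > m"
    unfolding n0_def by (rule LeastI)
  \<comment> \<open>The value at 0 rests on \<open>log 2 0 = 0\<close>. As \<open>m \<ge> 1\<close>,
    both values keep \<open>n0\<close> away from 0 and 1.\<close>
  have "ext_length \<gamma> 0 = 0" "ext_length \<gamma> 1 = 1"
    by (simp_all add: ext_length_def log_def)
  then have "n0 \<noteq> 0" "n0 \<noteq> 1"
    using n0 assms(2) by (metis not_less0, metis not_less)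
  then obtain n where n: "n0 = Suc n" "n \<ge> 1"
    by (metis One_nat_def Suc_le_eq not0_implies_Suc zero_less_iff_neq_zero)
  have "\<not> ext_length \<gamma> n > m"
    using not_less_Least[of n "\<lambda>n. ext_length \<gamma> n > m"] n unfolding n0_def by simp
  then have lt: "ext_length \<gamma> n < m"
    using assms(3)[of n] by linarith
  define j where "j = m - n"
  have j: "m = n + j" "j \<ge> 1"
    using lt by (auto simp: j_def ext_length_def)
  have "log 2 (real n) \<ge> 0" using n by simp
  then have "\<gamma> * log 2 (real n) \<ge> 0" using assms(1) by simp
  then have "\<lfloor>\<gamma> * log 2 (real n)\<rfloor> < int j"
    using lt j by (simp add: ext_length_def)
  then have "\<gamma> * log 2 (real n) < real j"
    by (simp add: floor_less_iff)
  moreover have "int j \<le> \<lfloor>\<gamma> * log 2 (real n + 1)\<rfloor>"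
    using n0 j n by (simp add: ext_length_def add.commute)
  then have "real j \<le> \<gamma> * log 2 (real n + 1)"
    by (simp add: le_floor_iff)
  ultimately show thesis
    using that n j by blast
qed

text \<open>Suppose \<open>m = n1 + j = n2 + i\<close> is skipped for both factors. If
  \<open>i \<ge> 2 * j\<close>, comparing logarithms gives \<open>n1 \<le> n2\<close>, although
  \<open>i > j\<close> means \<open>n2 < n1\<close>. Otherwise \<open>i \<le> 2 * j - 1\<close> by
  integrality, and the gap of 1 forces \<open>log (n1 + 1) - log n2 > 1 / (2 * g)\<close>; but
  \<open>n1\<close> exceeds \<open>n2\<close> by at most a logarithmic amount, so this difference is
  small for large \<open>m\<close>.\<close>

lemma ext_length_cover:
  fixes g :: real
  assumes "g > 0"
  shows "\<forall>\<^sub>F m in sequentially. \<exists>n. m = ext_length g n \<or> m = ext_length (2 * g) n"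
proof -
  have "((\<lambda>n. log 2 (real n + 1 + 2 * g * log 2 (real n + 1)) - log 2 (real n)) \<longlongrightarrow> 0) sequentially"
    by real_asymp
  then have "\<forall>\<^sub>F n in sequentially.
      log 2 (real n + 1 + 2 * g * log 2 (real n + 1)) - log 2 (real n) < 1 / (2 * g)"
    using assms by (intro order_tendstoD) auto
  then obtain N where N: "\<And>n. n \<ge> N \<Longrightarrow>
      log 2 (real n + 1 + 2 * g * log 2 (real n + 1)) - log 2 (real n) < 1 / (2 * g)"
    unfolding eventually_sequentially by blast
  have "\<forall>\<^sub>F m in sequentially. real m > real N + 2 * g * log 2 (real N + 1) \<and> m \<ge> 1"
    by (intro eventually_conj filterlim_at_top_dense[THEN iffD1, rule_format, OF filterlim_real_sequentially]
          eventually_ge_at_top)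
  then show ?thesis
  proof eventually_elim
    case (elim m)
    show ?case
    proof (rule ccontr)
      assume "\<not> ?case"
      then have no: "\<And>n. ext_length g n \<noteq> m" "\<And>n. ext_length (2 * g) n \<noteq> m" by metis+
      obtain n1 j where 1: "n1 \<ge> 1" "j \<ge> 1" "m = n1 + j" "g * log 2 (real n1) < real j"
        "real j \<le> g * log 2 (real n1 + 1)"
        using ext_length_skipped[OF _ _ no(1)] assms elim by blast
      obtain n2 i where 2: "n2 \<ge> 1" "i \<ge> 1" "m = n2 + i" "2 * g * log 2 (real n2) < real i"
        "real i \<le> 2 * g * log 2 (real n2 + 1)"
        using ext_length_skipped[OF _ _ no(2)] assms elim by auto
      show False
      proof (cases "i \<ge> 2 * j")
        case True
        then have "2 * g * log 2 (real n1) < 2 * g * log 2 (real n2 + 1)"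
          using 1 2 by linarith
        then have "log 2 (real n1) < log 2 (real n2 + 1)"
          using assms by simp
        then have "n1 \<le> n2"
          using 1 by simp
        then show False using True 1 2 by linarith
      next
        case False
        then have "2 * g * log 2 (real n2) < 2 * g * log 2 (real n1 + 1) - 1"
          using 1 2 by linarith
        then have "1 / (2 * g) < log 2 (real n1 + 1) - log 2 (real n2)"
          using assms by (simp add: field_simps)
        moreover have "real n1 + 1 \<le> real n2 + 1 + 2 * g * log 2 (real n2 + 1)"
          using 1 2 by linarith
        then have "log 2 (real n1 + 1) \<le> log 2 (real n2 + 1 + 2 * g * log 2 (real n2 + 1))"
          by simp
        moreover have "n2 \<ge> N"
        proof (rule ccontr)
          assume "\<not> n2 \<ge> N"
          then have "2 * g * log 2 (real n2 + 1) \<le> 2 * g * log 2 (real N + 1)"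
            using assms by simp
          then show False using elim 2 \<open>\<not> n2 \<ge> N\<close> by linarith
        qed
        ultimately show False using N[of n2] by linarith
      qed
    qed
  qed
qed

text \<open>The finitely many seed lengths below \<open>N\<close> have bounded output lengths, so a
  large \<open>m\<close> comes from a seed length of at least \<open>N\<close>.\<close>

lemma eventually_ext_length:
  fixes g :: real
  assumes "g > 0"
    and "\<forall>\<^sub>F n in sequentially. P (ext_length g n)"
    and "\<forall>\<^sub>F n in sequentially. P (ext_length (2 * g) n)"
  shows "\<forall>\<^sub>F m in sequentially. P m"
proof -
  obtain N where N: "\<And>n. n \<ge> N \<Longrightarrow> P (ext_length g n) \<and> P (ext_length (2 * g) n)"
    using eventually_conj[OF assms(2,3)] unfolding eventually_sequentially by blast
  have "\<forall>\<^sub>F m in sequentially. \<forall>n\<in>{..<N}. ext_length g n < m \<and> ext_length (2 * g) n < m"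
    by (intro eventually_ball_finite eventually_conj ballI eventually_gt_at_top) simp
  with ext_length_cover[OF assms(1)] show ?thesis
  proof eventually_elim
    case (elim m)
    then obtain n where n: "m = ext_length g n \<or> m = ext_length (2 * g) n" by blast
    then have "n \<ge> N"
      using elim(2) by (metis lessThan_iff less_irrefl not_le)
    then show ?case using n N by blast
  qed
qed

section \<open>Counting and entropy\<close>

lemma tm_result_mono:
  assumes "tm_result k M x s = Some y" "s \<le> t"
  shows "tm_result k M x t = Some y"
proof -
  obtain r where t: "t = r + s"
    using assms(2) by (metis add.commute le_Suc_ex)
  have "(tm_step M ^^ r) c = c" if "entry M c = None" for c
    using that by (induction r) (simp_all add: tm_step_def)
  then show ?thesis
    using assms(1) by (auto simp: tm_result_def t funpow_add Let_def split: if_splits)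
qed

lemma tm_result_unique:
  assumes "tm_result k M x s = Some y" "tm_result k M x t = Some z"
  shows "y = z"
  using assms tm_result_mono[of k M x s y t] tm_result_mono[of k M x t z s]
  by (cases "s \<le> t") auto

lemma emulated_output_unique:
  assumes "emulated_output l U \<pi> t y" "emulated_output l U \<pi> t z"
  shows "y = z"
  using assms tm_result_unique unfolding emulated_output_def by blast

text \<open>The constant depends on \<open>M\<close> alone. Emulation counts the steps of
  \<open>M\<close>, so the time bound \<open>t\<close> carries over without loss.\<close>

lemma universal_machine_description:
  assumes "universal_machine k l U" "tm_tapes k M"
  obtains c where "\<And>w t y. tm_result k M w t = Some y \<Longrightarrow>
    \<exists>\<pi>. emulated_output l U \<pi> t y \<and> length \<pi> \<le> length w + c"
proof -
  obtain decode and p :: "nat poly" where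
    dec: "\<And>M. tm_tapes k M \<Longrightarrow> \<exists>c. \<forall>w. \<exists>\<pi>. decode \<pi> = Some (M, w) \<and> length \<pi> \<le> length w + c"
    and run: "\<And>\<pi> t. tm_result l U (unary_pair t \<pi>) (poly p (length \<pi> + t)) =
           Some (case Option.bind (decode \<pi>) (\<lambda>(M, w). tm_result k M w t) of
                   None \<Rightarrow> [False] | Some y \<Rightarrow> True # y)"
    using assms(1) unfolding universal_machine_def by blast
  obtain c where c: "\<And>w. \<exists>\<pi>. decode \<pi> = Some (M, w) \<and> length \<pi> \<le> length w + c"
    using dec[OF assms(2)] by blast
  show thesis
  proof (rule that[of c])
    fix w t y assume y: "tm_result k M w t = Some y"
    obtain \<pi> where "decode \<pi> = Some (M, w)" "length \<pi> \<le> length w + c"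
      using c by blast
    moreover from this y have "emulated_output l U \<pi> t y"
      using run[of t \<pi>] unfolding emulated_output_def by auto
    ultimately show "\<exists>\<pi>. emulated_output l U \<pi> t y \<and> length \<pi> \<le> length w + c" by blast
  qed
qed

lemma Kt_le:
  assumes "emulated_output l U \<pi> (t (length x)) x"
  shows "Kt l U t x \<le> length \<pi>"
  unfolding Kt_def using assms by (intro cInf_lower) auto

text \<open>The empty table halts at once with its input as output, so every string has a
  description for every time bound and the infimum is over a nonempty set of naturals.\<close>

lemma Kt_attained:
  assumes "universal_machine k l U" "k \<ge> 1"
  obtains \<pi> where "length \<pi> = Kt l U t x" "emulated_output l U \<pi> (t (length x)) x"
proof -
  have "tm_tapes k []"
    using assms(2) by (simp add: tm_tapes_def)
  then obtain c where "\<And>w t y. tm_result k [] w t = Some y \<Longrightarrow>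
    \<exists>\<pi>. emulated_output l U \<pi> t y \<and> length \<pi> \<le> length w + c"
    using universal_machine_description[OF assms(1)] by blast
  moreover have "entry [] (init k x) = (None :: action option)"
    by (cases "init k x") simp
  then have "tm_result k [] x 0 = Some x"
    by (simp add: tm_result_def Let_def tm_output_init)
  then have "tm_result k [] x (t (length x)) = Some x"
    by (rule tm_result_mono) simp
  ultimately have "{length \<pi> | \<pi>. emulated_output l U \<pi> (t (length x)) x} \<noteq> {}"
    by blast
  then have "Kt l U t x \<in> {length \<pi> | \<pi>. emulated_output l U \<pi> (t (length x)) x}"
    unfolding Kt_def by (rule Inf_nat_def1)
  then show thesis using that by auto
qed

lemma finite_length_eq: "finite {x :: bool list. length x = n}"
  using finite_lists_length_eq[of "UNIV :: bool set" n] by simp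

lemma card_length_eq: "card {x :: bool list. length x = n} = 2 ^ n"
  using card_lists_length_eq[of "UNIV :: bool set" n] by simp

lemma length_eq_nonempty: "{x :: bool list. length x = n} \<noteq> {}"
  using length_replicate[of n True] by blast

text \<open>Strings of equal length have equal time bounds, so a shortest description determines its
  string, and fewer than \<open>2 ^ (a + 1)\<close> descriptions have length at most
  \<open>a\<close>.\<close>

lemma card_Kt_le:
  assumes "universal_machine k l U" "k \<ge> 1"
  shows "card {x. length x = m \<and> Kt l U t x \<le> a} \<le> 2 ^ (a + 1)"
proof -
  define desc where "desc x = (SOME \<pi>. length \<pi> = Kt l U t x \<and> emulated_output l U \<pi> (t (length x)) x)" for x
  have desc: "length (desc x) = Kt l U t x \<and> emulated_output l U (desc x) (t (length x)) x" for x
    unfolding desc_def by (rule someI_ex) (metis Kt_attained[OF assms])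
  have "inj_on desc {x. length x = m \<and> Kt l U t x \<le> a}"
    using desc emulated_output_unique by (intro inj_onI) (metis (mono_tags, lifting) mem_Collect_eq)
  then have "card {x. length x = m \<and> Kt l U t x \<le> a} \<le> card {\<pi> :: bool list. length \<pi> \<le> a}"
    using desc finite_lists_length_le[of "UNIV :: bool set" a] by (intro card_inj_on_le) auto
  also have "\<dots> = (\<Sum>i\<le>a. 2 ^ i)"
    using card_lists_length_le[of "UNIV :: bool set" a] by simp
  also have "\<dots> \<le> 2 ^ (a + 1)"
    using sum_power2[of "Suc a"] by (simp add: atLeast0LessThan lessThan_Suc_atMost)
  finally show ?thesis .
qed

section \<open>Uniform distribution and entropy\<close>

lemma pmf_unif: "length x = n \<Longrightarrow> pmf (unif n) x = 1 / 2 ^ n"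
  unfolding unif_def by (subst pmf_of_set[OF length_eq_nonempty finite_length_eq]) (simp add: card_length_eq)

lemma set_pmf_unif: "set_pmf (unif n) = {x. length x = n}"
  unfolding unif_def by (rule set_pmf_of_set[OF length_eq_nonempty finite_length_eq])

lemma pmf_bind_sum:
  assumes "finite L" "set_pmf A \<subseteq> L"
  shows "pmf (bind_pmf A D) z = (\<Sum>y\<in>L. pmf A y * pmf (D y) z)"
  using assms by (subst pmf_bind, subst integral_measure_pmf[of L]) auto

text \<open>Markov's inequality: \<open>N + log 2 (pmf P y)\<close> is nonnegative on the support
  with mean at most \<open>b\<close>, so it reaches \<open>2 * b\<close> with probability at most
  1/2. On the other points \<open>P\<close> has mass below \<open>2 powr (2 * b - N)\<close>. The
  fact \<open>summand\<close> states both cases pointwise.\<close>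

lemma entropy_deficiency_bound:
  assumes fin: "finite L" "set_pmf P \<subseteq> L" and f: "\<And>y. 0 \<le> f y" "\<And>y. f y \<le> 1"
    and low: "\<And>y. y \<in> set_pmf P \<Longrightarrow> pmf P y \<ge> 2 powr (- N)"
    and ent: "shannon_entropy P \<ge> N - b" and b: "b > 0"
  shows "(\<Sum>y\<in>L. pmf P y * f y) \<le> 1 / 2 + 2 powr (2 * b - N) * (\<Sum>y\<in>L. f y)"
proof -
  let ?S = "set_pmf P"
  have finS: "finite ?S" using fin finite_subset by blast
  have summand: "pmf P y * f y \<le> pmf P y * (N + log 2 (pmf P y)) / (2 * b) + 2 powr (2 * b - N) * f y"
    if y: "y \<in> ?S" for y
  proof -
    have pos: "pmf P y > 0" using y by (simp add: pmf_positive)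
    have "log 2 (pmf P y) \<ge> - N"
      using low[OF y] pos by (simp add: le_log_iff)
    then have nn: "N + log 2 (pmf P y) \<ge> 0" by simp
    show ?thesis
    proof (cases "N + log 2 (pmf P y) \<ge> 2 * b")
      case True
      then have "1 \<le> (N + log 2 (pmf P y)) / (2 * b)"
        using b by simp
      then have "pmf P y * f y \<le> pmf P y * ((N + log 2 (pmf P y)) / (2 * b))"
        using f(2)[of y] pos by (intro mult_left_mono) linarith+
      then show ?thesis using f(1)[of y] by (simp add: add_increasing2)
    next
      case False
      then have "pmf P y < 2 powr (2 * b - N)"
        using pos by (simp add: log_less_iff[symmetric])
      then have "pmf P y * f y \<le> 2 powr (2 * b - N) * f y"
        using f(1) by (intro mult_right_mono) auto
      then show ?thesis using nn b pos by (simp add: add_increasing)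
    qed
  qed
  have one: "(\<Sum>y\<in>?S. pmf P y) = 1"
    using finS by (intro sum_pmf_eq_1) auto
  have "(\<Sum>y\<in>L. pmf P y * f y) = (\<Sum>y\<in>?S. pmf P y * f y)"
    using fin by (intro sum.mono_neutral_right) (auto simp: set_pmf_iff)
  also have "\<dots> \<le> (\<Sum>y\<in>?S. pmf P y * (N + log 2 (pmf P y)) / (2 * b) + 2 powr (2 * b - N) * f y)"
    by (intro sum_mono summand)
  also have "\<dots> = (\<Sum>y\<in>?S. pmf P y * (N + log 2 (pmf P y))) / (2 * b) + 2 powr (2 * b - N) * (\<Sum>y\<in>?S. f y)"
    by (simp add: sum.distrib sum_distrib_left sum_divide_distrib)
  also have "(\<Sum>y\<in>?S. pmf P y * (N + log 2 (pmf P y))) = N - shannon_entropy P"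
    using one by (simp add: shannon_entropy_finite[OF finS] distrib_left sum.distrib flip: sum_distrib_right)
  also have "(N - shannon_entropy P) / (2 * b) \<le> 1 / 2"
    using ent b by (simp add: field_simps)
  also have "(\<Sum>y\<in>?S. f y) \<le> (\<Sum>y\<in>L. f y)"
    using fin f by (intro sum_mono2) auto
  finally show ?thesis by simp
qed

text \<open>Conditioning does not lower the mass of a point of \<open>E\<close>, and mapping by
  \<open>G\<close> only adds masses up.\<close>

lemma pmf_map_cond_unif_ge:
  assumes "E \<subseteq> {x. length x = n}" "E \<noteq> {}" "y \<in> set_pmf (map_pmf G (cond_pmf (unif n) E))"
  shows "pmf (map_pmf G (cond_pmf (unif n) E)) y \<ge> 2 powr (- real n)"
proof -
  let ?C = "cond_pmf (unif n) E"
  have ne: "set_pmf (unif n) \<inter> E \<noteq> {}"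
    using assms(1,2) by (auto simp: set_pmf_unif)
  obtain x where x: "x \<in> E" "y = G x"
    using assms(3) by (auto simp: set_cond_pmf[OF ne])
  have pos: "measure_pmf.prob (unif n) E > 0"
    using ne by (metis Int_commute measure_measure_pmf_not_zero zero_less_measure_iff)
  have "1 / 2 ^ n \<le> 1 / 2 ^ n / measure_pmf.prob (unif n) E"
    using pos measure_pmf.prob_le_1[of "unif n" E] by (simp add: field_simps)
  also have "\<dots> = pmf ?C x"
    using x assms(1) by (auto simp: pmf_cond[OF ne] pmf_unif)
  also have "\<dots> = measure_pmf.prob ?C {x}"
    by (simp add: measure_pmf_single)
  also have "\<dots> \<le> measure_pmf.prob ?C (G -` {y})"
    using x by (intro measure_pmf.finite_measure_mono) auto
  finally show ?thesis
    by (simp add: pmf_map powr_minus powr_realpow inverse_eq_divide)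
qed

section \<open>Hardness of approximation\<close>

lemma rate1_eventually_le:
  fixes T :: "nat \<Rightarrow> nat"
  assumes "(\<lambda>n. real (T n) - real n) \<in> O(\<lambda>n. real n powr e)" "e < 1" "\<epsilon> > 0"
  shows "\<forall>\<^sub>F n in sequentially. real (T n) \<le> (1 + \<epsilon>) * real n"
proof -
  have "(\<lambda>n. real n powr e) \<in> o(\<lambda>n. real n powr 1)"
    using assms(2) by (subst powr_smallo_iff[OF filterlim_real_sequentially]) simp_all
  with assms(1) have "(\<lambda>n. real (T n) - real n) \<in> o(\<lambda>n. real n powr 1)"
    by (rule landau_o.big_small_trans)
  from landau_o.smallD[OF this assms(3)] show ?thesis
    by eventually_elim (simp add: algebra_simps)
qed

lemma ext_length_bounds:
  assumes "\<gamma> > 0" "n \<ge> 1"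
  shows "n \<le> ext_length \<gamma> n" "real (ext_length \<gamma> n) \<le> real n + \<gamma> * log 2 (real n)"
    "real n + \<gamma> * log 2 (real n) - 1 \<le> real (ext_length \<gamma> n)"
proof -
  have "\<gamma> * log 2 (real n) \<ge> 0"
    using assms by simp
  then have "real (nat \<lfloor>\<gamma> * log 2 (real n)\<rfloor>) = of_int \<lfloor>\<gamma> * log 2 (real n)\<rfloor>"
    by simp
  then show "n \<le> ext_length \<gamma> n" "real (ext_length \<gamma> n) \<le> real n + \<gamma> * log 2 (real n)"
    "real n + \<gamma> * log 2 (real n) - 1 \<le> real (ext_length \<gamma> n)"
    unfolding ext_length_def by linarith+
qed

definition success_prob :: "real \<Rightarrow> (bool list \<Rightarrow> nat) \<Rightarrow> (bool list \<Rightarrow> bool list pmf) \<Rightarrow> nat \<Rightarrow> real" where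
  "success_prob d K H m =
     measure_pmf.prob (bind_pmf (unif m) (\<lambda>x. map_pmf (\<lambda>h. (x, h)) (H x)))
       {(x, h). \<bar>real (bits_nat h) - real (K x)\<bar> \<le> d * log 2 (real (length x))}"

lemma success_prob_sum:
  "success_prob d K H m = (\<Sum>x | length x = m. measure_pmf.prob (H x)
     {h. \<bar>real (bits_nat h) - real (K x)\<bar> \<le> d * log 2 (real m)}) / 2 ^ m"
proof -
  let ?good = "\<lambda>x h. \<bar>real (bits_nat h) - real (K x)\<bar> \<le> d * log 2 (real (length x))"
  have "success_prob d K H m =
      pmf (map_pmf (\<lambda>(x, h). ?good x h) (bind_pmf (unif m) (\<lambda>x. map_pmf (\<lambda>h. (x, h)) (H x)))) True"
    unfolding success_prob_def pmf_map by (rule arg_cong[where f = "measure_pmf.prob _"]) auto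
  also have "\<dots> = pmf (bind_pmf (unif m) (\<lambda>x. map_pmf (?good x) (H x))) True"
    by (simp add: map_bind_pmf pmf.map_comp o_def)
  also have "\<dots> = (\<Sum>x | length x = m. pmf (unif m) x * pmf (map_pmf (?good x) (H x)) True)"
    by (rule pmf_bind_sum) (simp_all add: finite_length_eq set_pmf_unif)
  also have "\<dots> = (\<Sum>x | length x = m. measure_pmf.prob (H x)
     {h. \<bar>real (bits_nat h) - real (K x)\<bar> \<le> d * log 2 (real m)} / 2 ^ m)"
    by (intro sum.cong refl) (auto simp: pmf_unif pmf_map vimage_def)
  finally show ?thesis by (simp add: sum_divide_distrib)
qed

text \<open>If the heuristic failed with probability at most \<open>1 / p m\<close> on uniform
  strings, the threshold distinguisher would have advantage at least 5/16. The exponent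
  \<open>e\<close> is fixed before \<open>p\<close> and \<open>H\<close>, so that one polynomial can
  serve two generators.\<close>

lemma hard_on_ext_length:
  fixes d \<epsilon> \<gamma> :: real and t :: "real poly"
  assumes U: "universal_machine k l U" and rate: "rate1_efficient k G"
    and prg: "cond_secure_ep_prg (\<lambda>n. 1 / real n ^ 2) \<gamma> G"
    and d: "d > 0" "\<gamma> > 2 * d" and \<epsilon>: "\<epsilon> > 0" and t: "\<And>n :: nat. poly t (real n) \<ge> (1 + \<epsilon>) * real n"
  obtains e :: nat where "\<And>p H. (\<And>m :: nat. p m \<ge> 16 * (1 + real m) ^ e) \<Longrightarrow> ppt H \<Longrightarrow>
    \<forall>\<^sub>F n in sequentially.
      success_prob d (Kt l U (\<lambda>n. nat \<lfloor>poly t (real n)\<rfloor>)) H (ext_length \<gamma> n) < 1 - 1 / p (ext_length \<gamma> n)"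
proof -
  define K where "K = Kt l U (\<lambda>n. nat \<lfloor>poly t (real n)\<rfloor>)"
  have \<gamma>: "\<gamma> > 0" using d by linarith
  obtain M T \<epsilon>' where M: "tm_tapes k M" "\<And>x. tm_result k M x (T (length x)) = Some (G x)"
    "\<epsilon>' < 1" "(\<lambda>n. real (T n) - real n) \<in> O(\<lambda>n. real n powr \<epsilon>')"
    using rate unfolding rate1_efficient_def by blast
  have k: "k \<ge> 1" using M(1) by (simp add: tm_tapes_def)
  obtain c where c: "\<And>w t y. tm_result k M w t = Some y \<Longrightarrow>
    \<exists>\<pi>. emulated_output l U \<pi> t y \<and> length \<pi> \<le> length w + c"
    using universal_machine_description[OF U M(1)] by blast
  have len: "\<And>x. length (G x) = ext_length \<gamma> (length x)"
    using prg unfolding cond_secure_ep_prg_def by simp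
  obtain E \<alpha>0 where "\<forall>n. E n \<subseteq> {x. length x = n} \<and> E n \<noteq> {}"
    and ind: "indistinguishable (\<lambda>n. 1 / real n ^ 2)
          (\<lambda>n. map_pmf G (cond_pmf (unif n) (E n))) (\<lambda>n. unif (ext_length \<gamma> n))"
    and ent: "\<forall>\<^sub>F n in sequentially.
           shannon_entropy (map_pmf G (cond_pmf (unif n) (E n))) \<ge> real n - \<alpha>0 * log 2 (real n)"
    using prg unfolding cond_secure_ep_prg_def by (elim conjE exE) rule
  then have E: "\<And>n. E n \<subseteq> {x. length x = n}" "\<And>n. E n \<noteq> {}"
    by auto
  \<comment> \<open>The maximum keeps the entropy deficiency \<open>\<alpha> * lg\<close> positive,
    as the Markov argument requires.\<close>
  define \<alpha> where "\<alpha> = max \<alpha>0 1"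
  define e where "e = nat \<lceil>2 * \<alpha> + \<gamma>\<rceil>"
  show thesis
  proof (rule that[of e])
    fix p :: "nat \<Rightarrow> real" and H
    assume p: "\<And>m :: nat. p m \<ge> 16 * (1 + real m) ^ e" and H: "ppt H"
    obtain D where D: "ppt_distinguisher D" "\<And>n y. n \<ge> 2 \<Longrightarrow> length y \<le> 2 * (n - 2) \<Longrightarrow>
       D n y = map_pmf (\<lambda>h. if 2 * bits_nat h \<le> n + length y - 1 then [True] else unary_pair n y) (H y)"
      using threshold_distinguisher[OF H] by blast
    define A where "A n = map_pmf G (cond_pmf (unif n) (E n))" for n
    have "\<forall>\<^sub>F n in sequentially. \<bar>pmf (bind_pmf (A n) (D n)) [True] -
        pmf (bind_pmf (unif (ext_length \<gamma> n)) (D n)) [True]\<bar> < 1 / real n ^ 2"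
      using ind D(1) unfolding indistinguishable_def A_def eventually_sequentially by blast
    \<comment> \<open>The first condition puts the output length within the range of the
      distinguisher; the second makes \<open>(\<gamma> - 2 * d) * log n\<close> at least
      \<open>2 * c + 10 + 2 * d\<close>, which separates the two complexities.\<close>
    moreover have "\<forall>\<^sub>F n in sequentially. \<gamma> * log 2 (real n) + 4 \<le> real n"
      by real_asymp
    moreover have "\<forall>\<^sub>F n in sequentially. (2 * real c + 10 + 2 * d) / (\<gamma> - 2 * d) \<le> log 2 (real n)"
      by real_asymp
    moreover note ent rate1_eventually_le[OF M(4,3) \<epsilon>] eventually_ge_at_top[of "5::nat"]
    ultimately have "\<forall>\<^sub>F n in sequentially.
      success_prob d K H (ext_length \<gamma> n) < 1 - 1 / p (ext_length \<gamma> n)"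
    proof eventually_elim
      case (elim n)
      define m where "m = ext_length \<gamma> n"
      define lg where "lg = log 2 (real n)"
      define L where "L = {y :: bool list. length y = m}"
      define s where "s y = measure_pmf.prob (H y)
        {h. \<bar>real (bits_nat h) - real (K y)\<bar> \<le> d * log 2 (real m)}" for y
      define acc where "acc y = measure_pmf.prob (H y) {h. 2 * bits_nat h \<le> n + m - 1}" for y
      have n: "n \<ge> 5" by fact
      have lg: "lg > 0" using n by (simp add: lg_def)
      have finL: "finite L" by (simp add: L_def finite_length_eq)
      have m: "n \<le> m" "real m \<le> real n + \<gamma> * lg" "real n + \<gamma> * lg - 1 \<le> real m"
        unfolding m_def lg_def using ext_length_bounds[OF \<gamma>] n by auto
      have "m \<le> 2 * (n - 2)"
        using m elim(2) n unfolding lg_def by linarith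
      \<comment> \<open>The threshold \<open>(n + m - 1) / 2\<close> thus leaves room for the error
        on both sides: above complexities up to \<open>n + c\<close> and below complexities from
        \<open>m - 4\<close> on.\<close>
      have gap: "2 * real c + 10 + 2 * d * (1 + lg) \<le> \<gamma> * lg"
        using elim(3) d unfolding lg_def by (simp add: field_simps)
      have "log 2 (real m) \<le> log 2 (2 * real n)"
        using \<open>m \<le> 2 * (n - 2)\<close> m n by simp
      also have "\<dots> = 1 + lg"
        unfolding lg_def using n by (subst log_mult) auto
      finally have logm: "d * log 2 (real m) \<le> d * (1 + lg)"
        using d by simp
      have acc_D: "pmf (D n y) [True] = acc y" if "y \<in> L" for y
      proof -
        have "D n y = map_pmf (\<lambda>h. if 2 * bits_nat h \<le> n + m - 1 then [True] else unary_pair n y) (H y)"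
          using that D(2)[of n y] n \<open>m \<le> 2 * (n - 2)\<close> by (simp add: L_def)
        moreover have "length (unary_pair n y) \<noteq> length [True]"
          using n by (simp add: unary_pair_def)
        then have "unary_pair n y \<noteq> [True]" by metis
        ultimately show ?thesis
          unfolding acc_def by (auto simp: pmf_map vimage_def intro!: arg_cong[where f = "measure_pmf.prob _"])
      qed
      have KG: "K y \<le> n + c" if yA: "y \<in> set_pmf (A n)" for y
      proof -
        have ne: "set_pmf (unif n) \<inter> E n \<noteq> {}"
          using E[of n] by (auto simp: set_pmf_unif)
        obtain x where x: "length x = n" "y = G x"
          using yA E(1)[of n] by (auto simp: A_def set_cond_pmf[OF ne])
        \<comment> \<open>The time bound is evaluated at the output length \<open>m \<ge> n\<close>,
          so it covers the run of \<open>G\<close> on a seed of length \<open>n\<close>.\<close>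
        have "real (T n) \<le> (1 + \<epsilon>) * real n" by fact
        also have "\<dots> \<le> (1 + \<epsilon>) * real m" using m(1) \<epsilon> by simp
        also have "\<dots> \<le> poly t (real m)" by (rule t)
        finally have "T n \<le> nat \<lfloor>poly t (real m)\<rfloor>" by (rule le_nat_floor)
        then have "tm_result k M x (nat \<lfloor>poly t (real m)\<rfloor>) = Some y"
          using M(2)[of x] x tm_result_mono by blast
        then obtain \<pi> where "emulated_output l U \<pi> (nat \<lfloor>poly t (real m)\<rfloor>) y" "length \<pi> \<le> n + c"
          using c x by blast
        moreover have "length y = m" using x len by (simp add: m_def)
        ultimately show ?thesis
          unfolding K_def using Kt_le[of l U \<pi> "\<lambda>n. nat \<lfloor>poly t (real n)\<rfloor>" y] by simp
      qed
      have sA: "set_pmf (A n) \<subseteq> L"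
      proof -
        have ne: "set_pmf (unif n) \<inter> E n \<noteq> {}"
          using E[of n] by (auto simp: set_pmf_unif)
        show ?thesis
          using E(1)[of n] len by (auto simp: A_def set_cond_pmf[OF ne] L_def m_def)
      qed
      have acc_ge: "acc y \<ge> s y" if "y \<in> set_pmf (A n)" for y
        unfolding acc_def s_def
      proof (intro measure_pmf.finite_measure_mono subsetI)
        fix h assume "h \<in> {h. \<bar>real (bits_nat h) - real (K y)\<bar> \<le> d * log 2 (real m)}"
        then have "real (bits_nat h) \<le> real (n + c) + d * (1 + lg)"
          using KG[OF that] logm by simp
        then have "2 * real (bits_nat h) \<le> real n + real m - 1"
          using gap m(3) by (simp add: algebra_simps)
        then show "h \<in> {h. 2 * bits_nat h \<le> n + m - 1}"
          using n by (intro CollectI) linarith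
      qed simp
      have acc_le: "acc y \<le> 1 - s y" if "K y > m - 5" for y
      proof -
        have "acc y \<le> measure_pmf.prob (H y)
            (- {h. \<bar>real (bits_nat h) - real (K y)\<bar> \<le> d * log 2 (real m)})"
          unfolding acc_def
        proof (intro measure_pmf.finite_measure_mono subsetI ComplI)
          fix h assume 1: "h \<in> {h. 2 * bits_nat h \<le> n + m - 1}"
            and 2: "h \<in> {h. \<bar>real (bits_nat h) - real (K y)\<bar> \<le> d * log 2 (real m)}"
          have "real (K y) \<ge> real m - 4" using that by linarith
          then have "2 * real (bits_nat h) \<ge> 2 * (real m - 4 - d * (1 + lg))"
            using 2 logm by simp
          moreover have "2 * real (bits_nat h) \<le> real n + real m - 1"
            using 1 n unfolding mem_Collect_eq by linarith
          ultimately show False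
            using gap m(3) by (simp add: algebra_simps)
        qed simp
        also have "\<dots> = 1 - s y"
          unfolding s_def by (subst measure_pmf.prob_compl[symmetric]) (auto simp: Compl_eq_Diff_UNIV)
        finally show ?thesis .
      qed
      \<comment> \<open>\<open>F\<close> is the failure probability of the heuristic on uniform
        strings.\<close>
      define F where "F = (\<Sum>y\<in>L. 1 - s y) / 2 ^ m"
      have s01: "0 \<le> s y" "s y \<le> 1" for y
        by (simp_all add: s_def)
      have succ: "success_prob d K H m = 1 - F"
        unfolding success_prob_sum F_def s_def[symmetric] L_def[symmetric] sum_subtractf
        by (simp add: L_def card_length_eq field_simps)
      have "pmf (bind_pmf (unif m) (D n)) [True] = (\<Sum>y\<in>L. pmf (unif m) y * pmf (D n y) [True])"
        using finL by (intro pmf_bind_sum) (auto simp: L_def set_pmf_unif)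
      also have "\<dots> = (\<Sum>y\<in>L. acc y / 2 ^ m)"
        by (intro sum.cong refl, subst acc_D) (auto simp: L_def pmf_unif)
      \<comment> \<open>Accepting a string of high complexity is a failure of the heuristic; the
        strings with complexity at most \<open>m - 5\<close> have density at most 1/16.\<close>
      also have "\<dots> \<le> (\<Sum>y\<in>L. (1 - s y) / 2 ^ m + (if K y \<le> m - 5 then 1 / 2 ^ m else 0))"
      proof (intro sum_mono)
        fix y
        have "acc y \<le> 1" by (simp add: acc_def)
        then show "acc y / 2 ^ m \<le> (1 - s y) / 2 ^ m + (if K y \<le> m - 5 then 1 / 2 ^ m else 0)"
          using acc_le[of y] s01[of y] by (auto simp: divide_right_mono simp flip: add_divide_distrib)
      qed
      also have "\<dots> = F + card {y. length y = m \<and> K y \<le> m - 5} / 2 ^ m"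
        unfolding F_def using finL
        by (simp add: sum.distrib sum_divide_distrib sum.If_cases L_def Int_def)
      also have "\<dots> \<le> F + 2 ^ (m - 5 + 1) / 2 ^ m"
        using of_nat_mono[OF card_Kt_le[OF U k, of m "\<lambda>n. nat \<lfloor>poly t (real n)\<rfloor>" "m - 5"], where 'a = real]
        unfolding K_def by (intro add_left_mono divide_right_mono) simp_all
      also have "(2 :: real) ^ m = 2 ^ (m - 5 + 1) * 2 ^ 4"
        unfolding power_add[symmetric] using n m(1) by (intro arg_cong[where f = "power 2"]) simp
      finally have unif_acc: "pmf (bind_pmf (unif m) (D n)) [True] \<le> F + 1 / 16"
        by simp
      have "(\<Sum>y\<in>L. pmf (A n) y * (1 - s y)) \<le> 1 / 2 + 2 powr (2 * (\<alpha> * lg) - real n) * (\<Sum>y\<in>L. 1 - s y)"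
      proof (rule entropy_deficiency_bound[OF finL sA])
        show "2 powr - real n \<le> pmf (A n) y" if "y \<in> set_pmf (A n)" for y
          using that unfolding A_def by (rule pmf_map_cond_unif_ge[OF E])
        have "\<alpha>0 * lg \<le> \<alpha> * lg" using lg by (simp add: \<alpha>_def)
        then show "real n - \<alpha> * lg \<le> shannon_entropy (A n)"
          using elim(4) unfolding A_def lg_def by linarith
        show "\<alpha> * lg > 0" using lg by (simp add: \<alpha>_def)
      qed (use s01 in auto)
      \<comment> \<open>The failures sum to \<open>2 ^ m * F\<close>, and
        \<open>m - n \<le> \<gamma> * lg\<close>, so the factor of \<open>F\<close> is at most
        \<open>n powr (2 * \<alpha> + \<gamma>)\<close>; this explains the choice of
        \<open>e\<close>.\<close>
      also have "2 powr (2 * (\<alpha> * lg) - real n) * (\<Sum>y\<in>L. 1 - s y) = 2 powr (2 * (\<alpha> * lg) + real m - real n) * F"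
        by (simp add: F_def powr_diff powr_add powr_realpow)
      also have "\<dots> \<le> (1 + real m) ^ e * F"
      proof (intro mult_right_mono)
        have "2 powr (2 * (\<alpha> * lg) + real m - real n) \<le> 2 powr (lg * (2 * \<alpha> + \<gamma>))"
          using m(2) by (simp add: algebra_simps)
        also have "\<dots> = real n powr (2 * \<alpha> + \<gamma>)"
          using n by (simp add: lg_def flip: powr_powr)
        also have "\<dots> \<le> real n powr real e"
          using n unfolding e_def by (intro powr_mono) linarith+
        also have "\<dots> \<le> (1 + real m) ^ e"
          using n m(1) by (simp add: powr_realpow power_mono)
        finally show "2 powr (2 * (\<alpha> * lg) + real m - real n) \<le> (1 + real m) ^ e" .
        show "F \<ge> 0" unfolding F_def using s01 by (intro divide_nonneg_nonneg sum_nonneg) auto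
      qed
      finally have "(\<Sum>y\<in>L. pmf (A n) y * (1 - s y)) \<le> 1 / 2 + (1 + real m) ^ e * F" by simp
      moreover have "(\<Sum>y\<in>L. pmf (A n) y * (1 - s y)) = 1 - (\<Sum>y\<in>L. pmf (A n) y * s y)"
        using sum_pmf_eq_1[OF finL sA] by (simp add: right_diff_distrib sum_subtractf)
      moreover have "(\<Sum>y\<in>L. pmf (A n) y * s y) \<le> (\<Sum>y\<in>L. pmf (A n) y * acc y)"
      proof (intro sum_mono)
        fix y show "pmf (A n) y * s y \<le> pmf (A n) y * acc y"
          using acc_ge[of y] by (cases "y \<in> set_pmf (A n)") (auto simp: set_pmf_iff mult_left_mono)
      qed
      moreover have "pmf (bind_pmf (A n) (D n)) [True] = (\<Sum>y\<in>L. pmf (A n) y * acc y)"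
        using pmf_bind_sum[OF finL sA, of "D n" "[True]"] by (simp add: acc_D)
      ultimately have A_acc: "pmf (bind_pmf (A n) (D n)) [True] \<ge> 1 / 2 - (1 + real m) ^ e * F"
        by linarith
      have "1 / real n ^ 2 \<le> 1 / 5 ^ 2"
        using n by (intro divide_left_mono power_mono) auto
      then have "5 / 16 > 1 / real n ^ 2" by simp
      then have "pmf (bind_pmf (A n) (D n)) [True] - pmf (bind_pmf (unif m) (D n)) [True] < 5 / 16"
        using elim(1) unfolding m_def by linarith
      then have lower: "1 / 2 - (1 + real m) ^ e * F - (F + 1 / 16) < 5 / 16"
        using A_acc unif_acc by linarith
      have ge1: "(1 + real m) ^ e \<ge> 1" by simp
      \<comment> \<open>The inequality \<open>lower\<close> forces
        \<open>(1 + real m) ^ e * F + F\<close> above 1/8, whereas a small \<open>F\<close> would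
        make each summand at most 1/16.\<close>
      have "\<not> F \<le> 1 / p m"
      proof
        assume "F \<le> 1 / p m"
        also have "\<dots> \<le> 1 / (16 * (1 + real m) ^ e)"
          using p[of m] ge1 by (intro divide_left_mono mult_pos_pos) linarith+
        finally have "(1 + real m) ^ e * F \<le> 1 / 16"
          using ge1 by (simp add: field_simps)
        moreover have "F \<ge> 0" unfolding F_def using s01 by (intro divide_nonneg_nonneg sum_nonneg) auto
        then have "F \<le> (1 + real m) ^ e * F" using ge1 by (simp add: mult_le_cancel_right1)
        ultimately show False using lower by linarith
      qed
      then show ?case
        using succ unfolding m_def by simp
    qed
    then show "\<forall>\<^sub>F n in sequentially.
      success_prob d (Kt l U (\<lambda>n. nat \<lfloor>poly t (real n)\<rfloor>)) H (ext_length \<gamma> n) < 1 - 1 / p (ext_length \<gamma> n)"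
      unfolding K_def .
  qed
qed

theorem theorem5p2:
  fixes k l :: nat and U :: tm
  assumes U: "universal_machine k l U"
    and G: "\<And>\<gamma> :: real. \<gamma> > 1 \<Longrightarrow>
      \<exists>G. rate1_efficient k G \<and> cond_secure_ep_prg (\<lambda>n. 1 / real n ^ 2) \<gamma> G"
  shows "\<forall>(d :: real) (\<epsilon> :: real) (t :: real poly).
    d > 0 \<longrightarrow> \<epsilon> > 0 \<longrightarrow> (\<forall>n :: nat. poly t (real n) \<ge> (1 + \<epsilon>) * real n) \<longrightarrow>
      mildly_hard_to_approximate (\<lambda>n. d * log 2 (real n))
        (Kt l U (\<lambda>n. nat \<lfloor>poly t (real n)\<rfloor>))"
proof (intro allI impI)
  fix d \<epsilon> :: real and t :: "real poly"
  assume d: "d > 0" and \<epsilon>: "\<epsilon> > 0" and t: "\<forall>n :: nat. poly t (real n) \<ge> (1 + \<epsilon>) * real n"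
  \<comment> \<open>Both \<open>g\<close> and \<open>2 * g\<close> must exceed 1, for generators to
    exist, and \<open>2 * d\<close>, for the threshold to separate.\<close>
  define g where "g = 2 * d + 2"
  have g: "g > 1" "2 * g > 1" "g > 2 * d" "2 * g > 2 * d" "g > 0"
    using d by (auto simp: g_def)
  let ?K = "Kt l U (\<lambda>n. nat \<lfloor>poly t (real n)\<rfloor>)"
  obtain G1 where G1: "rate1_efficient k G1" "cond_secure_ep_prg (\<lambda>n. 1 / real n ^ 2) g G1"
    using G[OF g(1)] by blast
  obtain G2 where G2: "rate1_efficient k G2" "cond_secure_ep_prg (\<lambda>n. 1 / real n ^ 2) (2 * g) G2"
    using G[OF g(2)] by blast
  obtain e1 :: nat where e1: "\<And>p H. (\<And>m :: nat. p m \<ge> 16 * (1 + real m) ^ e1) \<Longrightarrow> ppt H \<Longrightarrow>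
      \<forall>\<^sub>F n in sequentially. success_prob d ?K H (ext_length g n) < 1 - 1 / p (ext_length g n)"
    using hard_on_ext_length[OF U G1 d g(3) \<epsilon> t[rule_format]] by blast
  obtain e2 :: nat where e2: "\<And>p H. (\<And>m :: nat. p m \<ge> 16 * (1 + real m) ^ e2) \<Longrightarrow> ppt H \<Longrightarrow>
      \<forall>\<^sub>F n in sequentially. success_prob d ?K H (ext_length (2 * g) n) < 1 - 1 / p (ext_length (2 * g) n)"
    using hard_on_ext_length[OF U G2 d g(4) \<epsilon> t[rule_format]] by blast
  \<comment> \<open>The exponent \<open>e1 + e2\<close> dominates the lower bounds that the two
    generators impose on \<open>p\<close>.\<close>
  define p :: "real poly" where "p = 16 * [:1, 1:] ^ (e1 + e2)"
  have p: "poly p (real m) = 16 * (1 + real m) ^ (e1 + e2)" for m :: nat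
    by (simp add: p_def)
  have "\<forall>\<^sub>F m in sequentially. success_prob d ?K H m < 1 - 1 / poly p (real m)" if "ppt H" for H
  proof (rule eventually_ext_length[OF g(5)])
    show "\<forall>\<^sub>F n in sequentially. success_prob d ?K H (ext_length g n) < 1 - 1 / poly p (real (ext_length g n))"
      using that by (intro e1[of "\<lambda>m. poly p (real m)"]) (auto simp: p intro!: power_increasing)
    show "\<forall>\<^sub>F n in sequentially.
        success_prob d ?K H (ext_length (2 * g) n) < 1 - 1 / poly p (real (ext_length (2 * g) n))"
      using that by (intro e2[of "\<lambda>m. poly p (real m)"]) (auto simp: p intro!: power_increasing)
  qed
  moreover have "\<forall>n :: nat. poly p (real n) > 0"
    by (simp add: p)
  ultimately show "mildly_hard_to_approximate (\<lambda>n. d * log 2 (real n)) ?K"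
    unfolding mildly_hard_to_approximate_def success_prob_def by blast
qed

end
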